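(* Let $S\subset\partial\mathbb{D}$ be a nonempty closed subset. Then the algebra $AP(S)$ is the uniform closure in $L^{\infty}(\partial\mathbb{D})$ of the algebra of complex polynomials in the variables $g_{t_0}$ and $e^{i\lambda\log_{t_0^k}}$, where $\lambda\in\mathbb{R}$, $e^{it_0}\in S$, $k\in\{-1,1\}$.
   Context: $\mathbb{D}\subset\mathbb{C}$ is the open unit disk; $\partial\mathbb{D}$ carries the counterclockwise orientation. A continuous function $f:\mathbb{R}\to\mathbb{C}$ is almost periodic if for any $\epsilon>0$ there is $l(\epsilon)>0$ such that for every $t_0\in\mathbb{R}$ the interval $[t_0,t_0+l(\epsilon)]$ contains a number $\tau$ with $|f(t)-f(t+\tau)|<\epsilon$ for all $t\in\mathbb{R}$. For $t_0\in\mathbb{R}$, $k\in\{-1,1\}$, $0<s\le 2\pi$ set $\gamma_{t_0^k}(s):=\{e^{i(t_0+kt)}: 0<t<s\}$. A continuous function $f_k:\gamma_{t_0^k}(s)\to\mathbb{C}$ is almost periodic if the function $\widehat f_k:(-\infty,0)\to\mathbb{C}$, $\widehat f_k(t):=f_k(e^{i(t_0+kse^t)})$, is the restriction of an almost periodic function on $\mathbb{R}$. $AP(\partial\mathbb{D})\subset L^\infty(\partial\mathbb{D})$ is the uniform subalgebra of functions $f$ such that for each $t_0\in\mathbb{R}$ and $\epsilon>0$ there are $s=s(t_0,\epsilon)\in(0,\pi)$ and almost periodic functions $f_k:\gamma_{t_0^k}(s)\to\mathbb{C}$, $k\in\{-1,1\}$, with $\operatorname{ess\,sup}_{\gamma_{t_0^k}(s)}|f-f_k|<\epsilon$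 for both $k$. For a nonempty closed $S\subset\partial\mathbb{D}$, $AP(S)\subset AP(\partial\mathbb{D})$ is the uniform algebra of functions from $AP(\partial\mathbb{D})$ that are continuous on $\partial\mathbb{D}\setminus S$. For $t_0\in\mathbb{R}$ and $k\in\{-1,1\}$, $\log_{t_0^k}(e^{i(t_0+kt)}):=\ln t$ for $0<t<2\pi$. Fix a real continuous function $g$ on $\partial\mathbb{D}\setminus\{1\}$ such that $\lim_{t\to0+}g(e^{it})=1$, $\lim_{t\to2\pi-}g(e^{it})=0$, and $t\mapsto g(e^{it})$ is strictly decreasing on $(0,2\pi)$; set $g_{t_0}(e^{i(t_0+t)}):=g(e^{it})$ for $0<t<2\pi$. *)

theory Defs
  imports "HOL-Probability.Essential_Supremum" "HOL-Analysis.Analysis"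
begin

text \<open>
  Elements of \<open>L\<^sup>\<infinity>(\<partial>\<D>)\<close> are represented by functions \<open>complex \<Rightarrow> complex\<close>, of which only
  the values on the unit circle matter. Every set of elements of \<open>L\<^sup>\<infinity>(\<partial>\<D>)\<close> defined below
  (\<open>Linf\<close>, \<open>AP_circle\<close>, \<open>AP\<close>, \<open>Linf_closure P\<close>) consists of all representatives of its classes,
  i.e. it is closed under equality almost everywhere, so that equality of two such sets of
  functions is the same as equality of the corresponding sets of classes.
\<close>

lemma cis_measurable_circle:
  "cis \<in> lebesgue_on {0..<2*pi} \<rightarrow>\<^sub>M restrict_space borel (sphere 0 1)"
proof -
  have "cis \<in> borel_measurable lborel"
    by (simp add: borel_measurable_continuous_onI continuous_on_cis)
  then show ?thesis
    by (intro measurable_restrict_space2 measurable_restrict_space1 measurable_completion) auto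
qed

text \<open>Lebesgue (arc length) measure on the unit circle, of total mass \<open>2\<pi>\<close>.\<close>

definition circle_measure :: "complex measure" where
  "circle_measure =
     completion (distr (lebesgue_on {0..<2*pi}) (restrict_space borel (sphere 0 1)) cis)"

lemma space_circle_measure: "space circle_measure = sphere 0 1"
  by (simp add: circle_measure_def space_restrict_space)

lemma emeasure_circle_measure: "emeasure circle_measure (sphere 0 1) = ennreal (2*pi)"
proof -
  have "sphere 0 1 \<in> sets (restrict_space borel (sphere (0::complex) 1))"
    by (metis sets.top space_borel space_restrict_space Int_UNIV_right)
  moreover have "cis -` sphere 0 1 \<inter> space (lebesgue_on {0..<2*pi}) = {0..<2*pi}"
    by (auto simp: space_restrict_space)
  ultimately show ?thesis
    by (simp add: circle_measure_def emeasure_distr[OF cis_measurable_circle]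
        emeasure_restrict_space emeasure_completion)
qed

definition Linf_norm :: "(complex \<Rightarrow> complex) \<Rightarrow> ereal" where
  "Linf_norm f = esssup circle_measure (\<lambda>z. ereal (cmod (f z)))"

definition Linf :: "(complex \<Rightarrow> complex) set" where
  "Linf = {f. f \<in> borel_measurable circle_measure \<and> Linf_norm f < \<infinity>}"

definition Linf_closure :: "(complex \<Rightarrow> complex) set \<Rightarrow> (complex \<Rightarrow> complex) set" where
  "Linf_closure P = {f \<in> Linf. \<forall>\<epsilon>>0. \<exists>p\<in>P. Linf_norm (\<lambda>z. f z - p z) < ereal \<epsilon>}"

definition almost_periodic :: "(real \<Rightarrow> complex) \<Rightarrow> bool" where
  "almost_periodic f \<longleftrightarrow>
     continuous_on UNIV f \<and>
     (\<forall>\<epsilon>>0. \<exists>l>0. \<forall>t0. \<exists>\<tau>\<in>{t0..t0 + l}. \<forall>t. cmod (f t - f (t + \<tau>)) < \<epsilon>)"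

definition side_arc :: "real \<Rightarrow> int \<Rightarrow> real \<Rightarrow> complex set" where
  "side_arc t0 k s = {cis (t0 + of_int k * t) | t. 0 < t \<and> t < s}"

definition almost_periodic_on_arc :: "real \<Rightarrow> int \<Rightarrow> real \<Rightarrow> (complex \<Rightarrow> complex) \<Rightarrow> bool" where
  "almost_periodic_on_arc t0 k s f \<longleftrightarrow>
     continuous_on (side_arc t0 k s) f \<and>
     (\<exists>F. almost_periodic F \<and> (\<forall>t<0. f (cis (t0 + of_int k * s * exp t)) = F t))"

definition AP_circle :: "(complex \<Rightarrow> complex) set" where
  "AP_circle =
     {f \<in> Linf. \<forall>t0. \<forall>\<epsilon>>0. \<exists>s. 0 < s \<and> s < pi \<and>
        (\<exists>fk :: int \<Rightarrow> complex \<Rightarrow> complex. \<forall>k\<in>{-1, 1}.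
           almost_periodic_on_arc t0 k s (fk k) \<and>
           esssup (restrict_space circle_measure (side_arc t0 k s))
             (\<lambda>z. ereal (cmod (f z - fk k z))) < ereal \<epsilon>)}"

text \<open>Continuity of an element of \<open>L\<^sup>\<infinity>\<close> off \<open>S\<close> means that it has a representative that is
  continuous there.\<close>

definition AP :: "complex set \<Rightarrow> (complex \<Rightarrow> complex) set" where
  "AP S = {f \<in> AP_circle. \<exists>h. continuous_on (sphere 0 1 - S) h \<and>
             (AE z in circle_measure. z \<notin> S \<longrightarrow> f z = h z)}"

text \<open>\<open>log_at t0 k\<close> is characterised by the lemma \<open>log_at_cis\<close> below; its value at the single
  point \<open>cis t0\<close>, like that of \<open>g_at g t0\<close>, is irrelevant in \<open>L\<^sup>\<infinity>\<close>.\<close>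

definition log_at :: "real \<Rightarrow> int \<Rightarrow> complex \<Rightarrow> real" where
  "log_at t0 k z = ln (Arg2pi ((z / cis t0) powi k))"

lemma log_at_cis:
  assumes "k \<in> {-1, 1}" "0 < t" "t < 2*pi"
  shows "log_at t0 k (cis (t0 + of_int k * t)) = ln t"
proof -
  have "(cis (t0 + of_int k * t) / cis t0) powi k = exp (\<i> * of_real t)"
    using assms(1)
    by (auto simp: cis_divide power_int_minus exp_minus simp flip: cis_conv_exp cis_inverse)
  then show ?thesis
    using assms(2,3) by (simp add: log_at_def Arg2pi_exp)
qed

definition g_at :: "(complex \<Rightarrow> real) \<Rightarrow> real \<Rightarrow> complex \<Rightarrow> real" where
  "g_at g t0 z = g (z / cis t0)"

lemma g_at_cis: "g_at g t0 (cis (t0 + t)) = g (cis t)"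
  by (simp add: g_at_def cis_divide)

text \<open>The algebra of complex polynomials in the variables \<open>g_at g t0\<close> and \<open>exp (\<i> * l * log_at t0 k)\<close>
  with base points in \<open>S\<close>.\<close>

inductive_set AP_polynomials :: "(complex \<Rightarrow> real) \<Rightarrow> complex set \<Rightarrow> (complex \<Rightarrow> complex) set"
  for g :: "complex \<Rightarrow> real" and S :: "complex set" where
  const: "(\<lambda>_. c) \<in> AP_polynomials g S"
| g_var: "cis t0 \<in> S \<Longrightarrow> (\<lambda>z. of_real (g_at g t0 z)) \<in> AP_polynomials g S"
| exp_var: "cis t0 \<in> S \<Longrightarrow> k \<in> {-1, 1} \<Longrightarrow>
    (\<lambda>z. exp (\<i> * of_real (l * log_at t0 k z))) \<in> AP_polynomials g S"
| add: "p \<in> AP_polynomials g S \<Longrightarrow> q \<in> AP_polynomials g S \<Longrightarrow>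
    (\<lambda>z. p z + q z) \<in> AP_polynomials g S"
| mult: "p \<in> AP_polynomials g S \<Longrightarrow> q \<in> AP_polynomials g S \<Longrightarrow>
    (\<lambda>z. p z * q z) \<in> AP_polynomials g S"

end

theory Submission
  imports Defs "HOL-Complex_Analysis.Great_Picard"
begin

text \<open>
  In the coordinate \<open>ln t\<close>, an element of \<open>AP S\<close> is near each side of a point of the circle uniformly
  close to an almost periodic function. By Bohr's approximation theorem this function is a uniform
  limit of trigonometric polynomials, that is, of polynomials in the \<open>exp (\<i> * l * log_at t0 k)\<close>. By Stone--Weierstrass,
  the polynomials in a single \<open>g_at g t0\<close> approximate all continuous functions on the circle with a jump
  at \<open>cis t0\<close>; they provide the cut-offs to one side of \<open>cis t0\<close> and a partition of unity gluing
  the local approximants. Conversely, the generators are locally close to trigonometric polynomials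
  in \<open>ln t\<close>, and this property survives sums, products and uniform limits.

  Bohr's theorem is proved by finite Fourier analysis. Averaging an almost periodic sequence \<open>f\<close> over
  the differences of the set \<open>A\<close> of its \<open>\<epsilon>\<close>-almost periods in a window of length \<open>N\<close> changes it by at most
  \<open>2\<epsilon>\<close>, and multiplies its Fourier coefficients on a cyclic group of order \<open>4N\<close> by \<open>\<bar>\<alpha> r\<bar>\<^sup>2\<close>, where
  \<open>\<alpha>\<close> is the normalised Fourier transform of \<open>A\<close>. As \<open>A\<close> has positive density, Parseval's identity bounds the number of
  frequencies with \<open>\<bar>\<alpha> r\<bar> \<ge> \<eta>\<close> independently of \<open>N\<close>, and the others contribute little. Letting
  \<open>N\<close> tend to infinity along a subsequence gives the theorem on the integers; piecewise linear
  interpolation carries it over to the real line.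
\<close>

section \<open>Trigonometric polynomials\<close>

lemma cis_Arg_unit: "cmod z = 1 \<Longrightarrow> cis (Arg z) = z"
  by (subst cis_Arg) (auto simp: sgn_div_norm)

lemma cis_Arg2pi_unit: "cmod z = 1 \<Longrightarrow> cis (Arg2pi z) = z"
  using Arg2pi_eq[of z] by (simp add: cis_conv_exp)

inductive_set trig_polys :: "(real \<Rightarrow> complex) set" where
  monomial: "(\<lambda>t. c * cis (l * t)) \<in> trig_polys"
| add: "P \<in> trig_polys \<Longrightarrow> Q \<in> trig_polys \<Longrightarrow> (\<lambda>t. P t + Q t) \<in> trig_polys"

lemma trig_polys_const: "(\<lambda>t. c) \<in> trig_polys"
  using trig_polys.monomial[of c 0] by simp

lemma trig_polys_mult:
  assumes "P \<in> trig_polys" "Q \<in> trig_polys"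
  shows "(\<lambda>t. P t * Q t) \<in> trig_polys"
  using assms(1)
proof induction
  case (monomial c l)
  from assms(2) show ?case
  proof induction
    case (monomial d m)
    have "(\<lambda>t. c * cis (l * t) * (d * cis (m * t))) = (\<lambda>t. (c * d) * cis ((l + m) * t))"
      by (simp add: fun_eq_iff cis_mult algebra_simps)
    then show ?case
      using trig_polys.monomial by simp
  qed (auto simp: distrib_left intro: trig_polys.add)
qed (auto simp: distrib_right intro: trig_polys.add)

lemma trig_polys_affine:
  assumes "P \<in> trig_polys"
  shows "(\<lambda>t. P (a * t + b)) \<in> trig_polys"
  using assms
proof induction
  case (monomial c l)
  have "(\<lambda>t. c * cis (l * (a * t + b))) = (\<lambda>t. (c * cis (l * b)) * cis ((l * a) * t))"
    by (simp add: fun_eq_iff cis_mult algebra_simps)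
  then show ?case
    using trig_polys.monomial by simp
qed (auto intro: trig_polys.add)

lemma continuous_on_trig_poly: "P \<in> trig_polys \<Longrightarrow> continuous_on X P"
  by (induction rule: trig_polys.induct) (auto intro!: continuous_intros)

lemma trig_poly_bounded:
  assumes "P \<in> trig_polys"
  obtains B where "B > 0" "\<And>t. cmod (P t) \<le> B"
proof -
  from assms have "\<exists>B. \<forall>t. cmod (P t) \<le> B"
  proof induction
    case (monomial c l)
    then show ?case by (auto simp: norm_mult)
  next
    case (add P Q)
    then show ?case by (meson norm_triangle_mono)
  qed
  then obtain B where "\<And>t. cmod (P t) \<le> B" by blast
  then show ?thesis using that[of "max 1 B"] by (simp add: le_max_iff_disj)
qed

section \<open>Almost periodicity through totally bounded translates\<close>

text \<open>The range of \<open>s \<mapsto> f (\<cdot> + s)\<close> is totally bounded for the uniform distance. Unlike the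
  definition through relatively dense almost periods, this is evidently stable under sums.\<close>

definition totally_bounded_translates :: "(real \<Rightarrow> complex) \<Rightarrow> bool" where
  "totally_bounded_translates f \<longleftrightarrow>
     (\<forall>\<epsilon>>0. \<exists>X. finite X \<and> (\<forall>s. \<exists>x\<in>X. \<forall>t. cmod (f (t + s) - f (t + x)) < \<epsilon>))"

text \<open>Translation by \<open>s\<close> only multiplies the monomial by the unimodular number
  \<open>cis (l * s)\<close>, so a finite \<open>d\<close>-net of the unit circle, pulled back
  through \<open>Arg\<close>, yields the finite set of translates.\<close>

lemma totally_bounded_translates_monomial:
  "totally_bounded_translates (\<lambda>t. c * cis (l * t))"
  unfolding totally_bounded_translates_def
proof (intro allI impI)
  fix \<epsilon> :: real assume "\<epsilon> > 0"
  define d where "d = \<epsilon> / (cmod c + 1)"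
  have d: "d > 0" "cmod c * d < \<epsilon>"
    using \<open>\<epsilon> > 0\<close> unfolding d_def by (auto simp: field_simps add_pos_nonneg add_nonneg_pos)
  show "\<exists>X. finite X \<and> (\<forall>s. \<exists>x\<in>X. \<forall>t. cmod (c * cis (l * (t + s)) - c * cis (l * (t + x))) < \<epsilon>)"
  proof (cases "l = 0")
    case True
    then show ?thesis using \<open>\<epsilon> > 0\<close> by (intro exI[of _ "{0}"]) auto
  next
    case False
    have "seq_compact (sphere (0::complex) 1)"
      by (simp add: compact_imp_seq_compact)
    then obtain K where K: "finite K" "K \<subseteq> sphere 0 1" "sphere (0::complex) 1 \<subseteq> (\<Union>z\<in>K. ball z d)"
      using seq_compact_imp_totally_bounded d(1) by metis
    have "\<exists>x\<in>(\<lambda>z. Arg z / l) ` K. \<forall>t. cmod (c * cis (l * (t + s)) - c * cis (l * (t + x))) < \<epsilon>" for s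
    proof -
      have "cis (l * s) \<in> sphere 0 1" by simp
      then have "cis (l * s) \<in> (\<Union>z\<in>K. ball z d)"
        using K(3) by blast
      then obtain z where z: "z \<in> K" "cmod (z - cis (l * s)) < d"
        by (auto simp: dist_norm)
      define x where "x = Arg z / l"
      have x: "cis (l * x) = z"
        using z(1) K(2) False by (auto simp: x_def cis_Arg_unit)
      have "cmod (c * cis (l * (t + s)) - c * cis (l * (t + x))) < \<epsilon>" for t
      proof -
        have "c * cis (l * (t + s)) - c * cis (l * (t + x)) = c * cis (l * t) * (cis (l * s) - z)"
          by (simp add: distrib_left right_diff_distrib flip: cis_mult x)
        then have "cmod (c * cis (l * (t + s)) - c * cis (l * (t + x))) = cmod c * cmod (cis (l * s) - z)"
          by (simp add: norm_mult)
        also have "\<dots> \<le> cmod c * d"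
          using z(2) by (intro mult_left_mono) (auto simp: norm_minus_commute)
        finally show ?thesis using d(2) by simp
      qed
      then show ?thesis
        using z(1) x_def by blast
    qed
    then show ?thesis
      using K(1) by (intro exI[of _ "(\<lambda>z. Arg z / l) ` K"]) auto
  qed
qed

text \<open>The nets for \<open>f\<close> and \<open>g\<close> consist of different translates, so
  one common translate is chosen for every pair of net points that has one. Passing through the net
  points costs \<open>\<epsilon>/4\<close> four times.\<close>

lemma totally_bounded_translates_add:
  assumes "totally_bounded_translates f" "totally_bounded_translates g"
  shows "totally_bounded_translates (\<lambda>t. f t + g t)"
  unfolding totally_bounded_translates_def
proof (intro allI impI)
  fix \<epsilon> :: real assume "\<epsilon> > 0"
  then have "\<epsilon> / 4 > 0" by simp
  then obtain X where X: "finite X" "\<And>s. \<exists>x\<in>X. \<forall>t. cmod (f (t + s) - f (t + x)) < \<epsilon>/4"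
    using assms(1) unfolding totally_bounded_translates_def by meson
  obtain Y where Y: "finite Y" "\<And>s. \<exists>x\<in>Y. \<forall>t. cmod (g (t + s) - g (t + x)) < \<epsilon>/4"
    using assms(2) \<open>\<epsilon> / 4 > 0\<close> unfolding totally_bounded_translates_def by meson
  define C where "C p s \<longleftrightarrow> (\<forall>t. cmod (f (t + s) - f (t + fst p)) < \<epsilon>/4) \<and>
      (\<forall>t. cmod (g (t + s) - g (t + snd p)) < \<epsilon>/4)" for p and s :: real
  \<comment> \<open>For a pair without a common translate \<open>SOME\<close> returns an arbitrary
    number; this is harmless, since \<open>?Z\<close> only has to be finite.\<close>
  let ?Z = "(\<lambda>p. SOME s. C p s) ` (X \<times> Y)"
  have "\<exists>z\<in>?Z. \<forall>t. cmod (f (t + s) + g (t + s) - (f (t + z) + g (t + z))) < \<epsilon>" for s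
  proof -
    obtain x y where xy: "x \<in> X" "y \<in> Y" "C (x, y) s"
      using X(2)[of s] Y(2)[of s] by (auto simp: C_def)
    define z where "z = (SOME s. C (x, y) s)"
    have z: "C (x, y) z"
      unfolding z_def using xy(3) by (rule someI)
    have "cmod (f (t + s) + g (t + s) - (f (t + z) + g (t + z))) < \<epsilon>" for t
    proof -
      have "cmod (f (t + s) - f (t + x)) < \<epsilon>/4" "cmod (f (t + z) - f (t + x)) < \<epsilon>/4"
        "cmod (g (t + s) - g (t + y)) < \<epsilon>/4" "cmod (g (t + z) - g (t + y)) < \<epsilon>/4"
        using xy(3) z by (auto simp: C_def)
      then show ?thesis
        using norm_diff_triangle_ineq[of "f (t + s)" "g (t + s)" "f (t + z)" "g (t + z)"]
          norm_triangle_ineq4[of "f (t + s) - f (t + x)" "f (t + z) - f (t + x)"]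
          norm_triangle_ineq4[of "g (t + s) - g (t + y)" "g (t + z) - g (t + y)"]
        by simp
    qed
    then show ?thesis
      using xy(1,2) z_def by blast
  qed
  then show "\<exists>X. finite X \<and> (\<forall>s. \<exists>x\<in>X. \<forall>t. cmod (f (t + s) + g (t + s) - (f (t + x) + g (t + x))) < \<epsilon>)"
    using X(1) Y(1) by (intro exI[of _ ?Z]) auto
qed

text \<open>If the translates by \<open>t0 + L\<close> and by the net point \<open>x\<close> are
  close, then \<open>t0 + L - x\<close> is an almost period. Aiming at the midpoint of the window,
  with \<open>L\<close> bounding the net, keeps it inside the length \<open>2*L\<close>.\<close>

lemma totally_bounded_translates_imp_almost_periodic:
  assumes "continuous_on UNIV f" "totally_bounded_translates f"
  shows "almost_periodic f"
  unfolding almost_periodic_def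
proof (intro conjI assms(1) allI impI)
  fix \<epsilon> :: real assume "\<epsilon> > 0"
  then obtain X where X: "finite X" "\<And>s. \<exists>x\<in>X. \<forall>t. cmod (f (t + s) - f (t + x)) < \<epsilon>"
    using assms(2) unfolding totally_bounded_translates_def by meson
  obtain L where L: "L > 0" "\<And>x. x \<in> X \<Longrightarrow> \<bar>x\<bar> \<le> L"
    using finite_imp_bounded[OF X(1)] unfolding bounded_pos real_norm_def by blast
  show "\<exists>l>0. \<forall>t0. \<exists>\<tau>\<in>{t0..t0 + l}. \<forall>t. cmod (f t - f (t + \<tau>)) < \<epsilon>"
  proof (intro exI[of _ "2*L"] conjI allI)
    fix t0 :: real
    obtain x where x: "x \<in> X" "\<And>t. cmod (f (t + (t0 + L)) - f (t + x)) < \<epsilon>"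
      using X(2) by blast
    have "cmod (f t - f (t + (t0 + L - x))) < \<epsilon>" for t
      using x(2)[of "t - x"] by (simp add: algebra_simps norm_minus_commute)
    moreover have "t0 + L - x \<in> {t0..t0 + 2*L}"
      using L(2)[OF x(1)] by auto
    ultimately show "\<exists>\<tau>\<in>{t0..t0 + 2*L}. \<forall>t. cmod (f t - f (t + \<tau>)) < \<epsilon>"
      by blast
  qed (use L in auto)
qed

lemma trig_poly_almost_periodic:
  assumes "P \<in> trig_polys"
  shows "almost_periodic P"
proof -
  from assms have "totally_bounded_translates P"
    by induction (auto intro: totally_bounded_translates_monomial totally_bounded_translates_add)
  with continuous_on_trig_poly[OF assms] show ?thesis
    by (rule totally_bounded_translates_imp_almost_periodic)
qed

section \<open>Uniform limits of trigonometric polynomials\<close>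

definition trig_limit :: "(real \<Rightarrow> complex) \<Rightarrow> bool" where
  "trig_limit f \<longleftrightarrow> (\<forall>\<epsilon>>0. \<exists>P\<in>trig_polys. \<forall>t. cmod (f t - P t) < \<epsilon>)"

lemma trig_limit_trig_poly: "P \<in> trig_polys \<Longrightarrow> trig_limit P"
  unfolding trig_limit_def by force

lemma trig_limit_add:
  assumes "trig_limit f" "trig_limit g"
  shows "trig_limit (\<lambda>t. f t + g t)"
  unfolding trig_limit_def
proof (intro allI impI)
  fix \<epsilon> :: real assume "\<epsilon> > 0"
  then have "\<epsilon>/2 > 0" by simp
  obtain P where P: "P \<in> trig_polys" "\<And>t. cmod (f t - P t) < \<epsilon>/2"
    using assms(1) \<open>\<epsilon>/2 > 0\<close> unfolding trig_limit_def by meson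
  obtain Q where Q: "Q \<in> trig_polys" "\<And>t. cmod (g t - Q t) < \<epsilon>/2"
    using assms(2) \<open>\<epsilon>/2 > 0\<close> unfolding trig_limit_def by meson
  have "cmod (f t + g t - (P t + Q t)) < \<epsilon>" for t
    using norm_diff_triangle_ineq[of "f t" "g t" "P t" "Q t"] P(2)[of t] Q(2)[of t]
    by linarith
  then show "\<exists>P\<in>trig_polys. \<forall>t. cmod (f t + g t - P t) < \<epsilon>"
    using trig_polys.add[OF P(1) Q(1)] by (intro bexI[of _ "\<lambda>t. P t + Q t"]) auto
qed

lemma trig_limit_mult_poly:
  assumes "trig_limit f" "Q \<in> trig_polys"
  shows "trig_limit (\<lambda>t. Q t * f t)"
  unfolding trig_limit_def
proof (intro allI impI)
  fix \<epsilon> :: real assume "\<epsilon> > 0"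
  obtain B where B: "B > 0" "\<And>t. cmod (Q t) \<le> B"
    using trig_poly_bounded[OF assms(2)] by blast
  then have "\<epsilon>/B > 0" using \<open>\<epsilon> > 0\<close> by simp
  then obtain P where P: "P \<in> trig_polys" "\<And>t. cmod (f t - P t) < \<epsilon>/B"
    using assms unfolding trig_limit_def by meson
  have "cmod (Q t * f t - Q t * P t) < \<epsilon>" for t
  proof -
    have "cmod (Q t * f t - Q t * P t) = cmod (Q t) * cmod (f t - P t)"
      by (simp add: right_diff_distrib flip: norm_mult)
    also have "\<dots> \<le> B * cmod (f t - P t)"
      using B by (simp add: mult_right_mono)
    also have "\<dots> < B * (\<epsilon>/B)"
      using B P by (intro mult_strict_left_mono)
    finally show ?thesis using B by simp
  qed
  then show "\<exists>P\<in>trig_polys. \<forall>t. cmod (Q t * f t - P t) < \<epsilon>"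
    using trig_polys_mult[OF assms(2) P(1)] by (intro bexI[of _ "\<lambda>t. Q t * P t"]) auto
qed

lemma trig_limit_sum:
  "finite I \<Longrightarrow> (\<And>i. i \<in> I \<Longrightarrow> trig_limit (f i)) \<Longrightarrow> trig_limit (\<lambda>t. \<Sum>i\<in>I. f i t)"
  by (induction I rule: finite_induct)
    (auto intro: trig_limit_trig_poly trig_polys_const trig_limit_add)

lemma trig_limit_limit:
  assumes "\<And>\<epsilon>. \<epsilon> > 0 \<Longrightarrow> \<exists>h. trig_limit h \<and> (\<forall>t. cmod (f t - h t) \<le> \<epsilon>)"
  shows "trig_limit f"
  unfolding trig_limit_def
proof (intro allI impI)
  fix \<epsilon> :: real assume "\<epsilon> > 0"
  then have e: "\<epsilon>/2 > 0" by simp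
  obtain h where h: "trig_limit h" "\<And>t. cmod (f t - h t) \<le> \<epsilon>/2"
    using assms[OF e] by blast
  then obtain P where P: "P \<in> trig_polys" "\<And>t. cmod (h t - P t) < \<epsilon>/2"
    using e unfolding trig_limit_def by meson
  have "cmod (f t - P t) < \<epsilon>" for t
    using norm_diff_triangle_le[OF h(2)[of t] order.refl[of "cmod (h t - P t)"]] P(2)[of t] by linarith
  then show "\<exists>P\<in>trig_polys. \<forall>t. cmod (f t - P t) < \<epsilon>"
    using P(1) by blast
qed

text \<open>Along the unit circle a real linear functional is a combination of \<open>cos t\<close>
  and \<open>sin t\<close>, hence of \<open>cis t\<close> and \<open>cis (- t)\<close>; sums and
  products stay in \<open>trig_polys\<close>.\<close>

lemma real_polynomial_cis_trig_poly:
  assumes "real_polynomial_function (p :: complex \<Rightarrow> real)"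
  shows "(\<lambda>t. of_real (p (cis t))) \<in> trig_polys"
  using assms
proof induction
  case (linear f)
  interpret bounded_linear f by fact
  have "f (cis t) = cos t * f 1 + sin t * f \<i>" for t
  proof -
    have "cis t = cos t *\<^sub>R 1 + sin t *\<^sub>R \<i>"
      by (simp add: complex_eq_iff)
    then show ?thesis by (simp only: add scaleR) simp
  qed
  then have "(\<lambda>t. complex_of_real (f (cis t))) =
      (\<lambda>t. (of_real (f 1) - \<i> * of_real (f \<i>)) / 2 * cis (1 * t) +
           (of_real (f 1) + \<i> * of_real (f \<i>)) / 2 * cis ((-1) * t))"
    by (simp add: fun_eq_iff complex_eq_iff field_simps)
  then show ?case
    by (simp only: trig_polys.intros)
qed (auto intro: trig_polys_const trig_polys.add trig_polys_mult)

lemma periodic_int_multiple: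
  fixes q :: "real \<Rightarrow> 'a"
  assumes "\<And>t. q (t + p) = q t"
  shows "q (t + of_int n * p) = q t"
proof (induction n arbitrary: t rule: int_induct[where k = 0])
  case (step1 i)
  then show ?case using assms[of "t + of_int i * p"] by (simp add: algebra_simps)
next
  case (step2 i)
  then show ?case using assms[of "t + of_int (i - 1) * p"] by (simp add: algebra_simps)
qed simp

lemma cis_eq_imp_int_multiple:
  assumes "cis a = cis b"
  obtains n :: int where "a = b + of_int n * (2 * pi)"
proof -
  have "sin a = sin b \<and> cos a = cos b"
    using assms by (simp add: complex_eq_iff)
  then show ?thesis
    using sin_cos_eq_iff[of a b] that by (auto simp: algebra_simps)
qed

text \<open>A function of period \<open>2 * pi\<close> descends to a continuous function on the unit
  circle, where polynomials in the real coordinates are dense by Stone--Weierstrass.\<close>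

lemma periodic_trig_limit:
  assumes q: "continuous_on UNIV q" "\<And>t. q (t + 2 * pi) = q t"
  shows "trig_limit q"
proof -
  have q': "q a = q b" if "cis a = cis b" for a b
    using cis_eq_imp_int_multiple[OF that] periodic_int_multiple[of q, OF q(2)] by metis
  have eq2: "q (Arg z) = q (Arg2pi z)" if "z \<noteq> 0" for z
  proof -
    have "cis (Arg2pi z) = sgn z"
      using Arg2pi_eq[of z, symmetric] that
      by (simp add: cis_conv_exp sgn_eq nonzero_eq_divide_eq mult.commute)
    then show ?thesis
      using that by (intro q') (simp add: cis_Arg)
  qed
  have isc: "isCont q x" for x
    using q(1) by (simp add: continuous_on_eq_continuous_at)
  \<comment> \<open>\<open>Arg\<close> jumps across the negative axis and \<open>Arg2pi\<close>
    across the positive one; \<open>q\<close> does not see which is used, so at every nonzero point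
    one of the two gives continuity.\<close>
  have cont: "isCont (\<lambda>z. q (Arg z)) z" if "z \<noteq> 0" for z
  proof (cases "z \<in> \<real>\<^sub>\<le>\<^sub>0")
    case False
    then show ?thesis
      by (intro isCont_o2[of z Arg q] continuous_at_Arg isc)
  next
    case True
    then have "z \<notin> \<real>\<^sub>\<ge>\<^sub>0"
      using that by (auto simp: complex_nonneg_Reals_iff complex_nonpos_Reals_iff complex_eq_iff)
    then have c: "isCont (\<lambda>z. q (Arg2pi z)) z"
      by (intro isCont_o2[of z Arg2pi q] continuous_at_Arg2pi isc)
    have ev: "\<forall>\<^sub>F w in nhds z. q (Arg2pi w) = q (Arg w)"
      using t1_space_nhds[OF that] by (rule eventually_mono) (simp add: eq2)
    show ?thesis
      by (rule iffD1[OF isCont_cong[OF ev] c])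
  qed
  show ?thesis
    unfolding trig_limit_def
  proof (intro allI impI)
    fix \<epsilon> :: real assume "\<epsilon> > 0"
    have "continuous_on (sphere 0 1) (\<lambda>z. q (Arg z))"
      by (intro continuous_at_imp_continuous_on ballI cont) auto
    from Stone_Weierstrass_polynomial_function[OF compact_sphere this \<open>\<epsilon> > 0\<close>]
    obtain G where "polynomial_function G" "\<forall>z\<in>sphere 0 1. cmod (q (Arg z) - G z) < \<epsilon>"
      by blast
    then have G: "polynomial_function G" "\<And>z. cmod z = 1 \<Longrightarrow> cmod (q (Arg z) - G z) < \<epsilon>"
      by simp_all
    have "real_polynomial_function (Re \<circ> G)" "real_polynomial_function (Im \<circ> G)"
      using G(1) unfolding polynomial_function_def by (simp_all add: bounded_linear_Re bounded_linear_Im)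
    then have "(\<lambda>t. of_real ((Re \<circ> G) (cis t)) + \<i> * of_real ((Im \<circ> G) (cis t))) \<in> trig_polys"
      by (intro trig_polys.add trig_polys_mult trig_polys_const real_polynomial_cis_trig_poly)
    then have "(\<lambda>t. G (cis t)) \<in> trig_polys"
      by (simp flip: complex_eq)
    moreover have "cmod (q t - G (cis t)) < \<epsilon>" for t
    proof -
      have "q (Arg (cis t)) = q t"
        by (rule q') (simp add: cis_Arg_unit)
      then show ?thesis
        using G(2)[of "cis t"] by simp
    qed
    ultimately show "\<exists>P\<in>trig_polys. \<forall>t. cmod (q t - P t) < \<epsilon>"
      by (intro bexI[of _ "\<lambda>t. G (cis t)"]) auto
  qed
qed

section \<open>Bohr's approximation theorem\<close>

lemma sum_cis_geometric:
  fixes n :: int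
  assumes "P > 0" "\<bar>n\<bar> < int P"
  shows "(\<Sum>r<P. cis (2 * pi * real r * of_int n / real P)) = (if n = 0 then of_nat P else 0)"
proof (cases "n = 0")
  case False
  define w where "w = cis (2 * pi * of_int n / real P)"
  have pow: "cis (2 * pi * real r * of_int n / real P) = w ^ r" for r
    by (simp add: w_def Complex.DeMoivre mult_ac)
  have "w ^ P = cis (2 * pi * of_int n)"
    using assms(1) by (simp add: w_def Complex.DeMoivre mult_ac)
  then have "w ^ P = 1" by simp
  \<comment> \<open>If \<open>w\<close> were 1, then \<open>n\<close> would be a multiple of
    \<open>P\<close>, which its bound excludes for nonzero \<open>n\<close>.\<close>
  moreover have "w \<noteq> 1"
  proof
    assume "w = 1"
    then have "cis (2 * pi * of_int n / real P) = cis 0" by (simp add: w_def)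
    then obtain m :: int where "2 * pi * of_int n / real P = 0 + of_int m * (2 * pi)"
      by (rule cis_eq_imp_int_multiple)
    then have "real_of_int n = of_int (m * int P)"
      using assms(1) by (simp add: field_simps)
    then have "n = m * int P" by linarith
    then show False
      using assms(2) False zdvd_imp_le[of "int P" "\<bar>n\<bar>"] by simp
  qed
  ultimately show ?thesis
    using False by (simp add: pow geometric_sum)
qed simp

lemma sum_cis_orthogonal:
  assumes "y < P" "y' < P"
  shows "(\<Sum>r<P. cis (2 * pi * real r * real y / real P) * cnj (cis (2 * pi * real r * real y' / real P)))
    = (if y = y' then of_nat P else 0)"
proof -
  have "cis (2 * pi * real r * real y / real P) * cnj (cis (2 * pi * real r * real y' / real P)) =
      cis (2 * pi * real r * of_int (int y - int y') / real P)" for r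
    by (simp add: cis_cnj cis_mult diff_divide_distrib right_diff_distrib)
  then show ?thesis
    using sum_cis_geometric[of P "int y - int y'"] assms by auto
qed

text \<open>The square is expanded and the sum over frequencies taken first, where orthogonality
  leaves only the diagonal. The transform is unnormalised, hence the factor
  \<open>P\<close>.\<close>

lemma parseval:
  fixes u :: "nat \<Rightarrow> complex"
  shows "(\<Sum>r<P. (cmod (\<Sum>y<P. u y * cis (2 * pi * real r * real y / real P)))\<^sup>2) = P * (\<Sum>y<P. (cmod (u y))\<^sup>2)"
proof -
  let ?e = "\<lambda>r y. cis (2 * pi * real r * real y / real P)"
  have "complex_of_real (\<Sum>r<P. (cmod (\<Sum>y<P. u y * ?e r y))\<^sup>2) =
      (\<Sum>r<P. (\<Sum>y<P. u y * ?e r y) * cnj (\<Sum>y<P. u y * ?e r y))"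
    by (simp only: of_real_sum complex_norm_square)
  also have "\<dots> = (\<Sum>r<P. \<Sum>y<P. \<Sum>y'<P. (u y * cnj (u y')) * (?e r y * cnj (?e r y')))"
    by (simp add: sum_product cnj_sum mult_ac)
  also have "\<dots> = (\<Sum>y<P. \<Sum>y'<P. (u y * cnj (u y')) * (\<Sum>r<P. ?e r y * cnj (?e r y')))"
    unfolding sum_distrib_left
    by (subst sum.swap, rule sum.cong[OF refl], rule sum.swap)
  also have "\<dots> = (\<Sum>y<P. \<Sum>y'<P. (u y * cnj (u y')) * (if y = y' then of_nat P else 0))"
    by (intro sum.cong refl) (simp add: sum_cis_orthogonal)
  also have "\<dots> = (\<Sum>y<P. u y * cnj (u y) * of_nat P)"
    by (intro sum.cong refl) (simp add: if_distrib[of "(*) _"] sum.delta cong: if_cong)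
  also have "\<dots> = complex_of_real (P * (\<Sum>y<P. (cmod (u y))\<^sup>2))"
    unfolding of_real_mult of_real_sum complex_norm_square sum_distrib_left by (simp add: mult_ac)
  finally show ?thesis
    by (simp only: of_real_eq_iff)
qed

lemma dft_inversion:
  fixes F :: "nat \<Rightarrow> complex"
  assumes "y < P"
  shows "F y = (\<Sum>r<P. (\<Sum>x<P. F x * cnj (cis (2 * pi * real r * real x / real P))) / P
                  * cis (2 * pi * real r * real y / real P))"
proof -
  let ?e = "\<lambda>r y. cis (2 * pi * real r * real y / real P)"
  have "(\<Sum>r<P. (\<Sum>x<P. F x * cnj (?e r x)) / P * ?e r y) =
      (\<Sum>r<P. \<Sum>x<P. F x / P * (?e r y * cnj (?e r x)))"
    unfolding sum_divide_distrib sum_distrib_right by (simp add: mult_ac)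
  also have "\<dots> = (\<Sum>x<P. F x / P * (\<Sum>r<P. ?e r y * cnj (?e r x)))"
    unfolding sum_distrib_left by (rule sum.swap)
  also have "\<dots> = (\<Sum>x<P. F x / P * (if y = x then of_nat P else 0))"
    using assms by (intro sum.cong refl) (simp add: sum_cis_orthogonal)
  also have "\<dots> = F y"
    using assms by (simp add: if_distrib[of "(*) _"] sum.delta' cong: if_cong)
  finally show ?thesis by simp
qed

section \<open>Approximation of almost periodic sequences by exponential sums\<close>

lemma card_almost_periods:
  fixes E :: "int set"
  assumes "\<And>m. \<exists>\<tau>\<in>{m..m + int L}. \<tau> \<in> E"
  shows "card {a. a < M * Suc L \<and> int a \<in> E} \<ge> M"
proof -
  \<comment> \<open>One element is picked from each of \<open>M\<close> disjoint blocks of length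
    \<open>Suc L\<close>. Division by \<open>Suc L\<close> recovers the block, so the picks are
    distinct.\<close>
  have "\<exists>a. i * Suc L \<le> a \<and> a \<le> i * Suc L + L \<and> int a \<in> E" for i
  proof -
    obtain \<tau> where "\<tau> \<in> {int (i * Suc L)..int (i * Suc L) + int L}" "\<tau> \<in> E"
      using assms by blast
    moreover from this have "int (nat \<tau>) = \<tau>"
      using of_nat_0_le_iff[of "i * Suc L", where 'a = int] by (simp del: of_nat_mult)
    ultimately show ?thesis
      by (intro exI[of _ "nat \<tau>"]) (auto simp del: of_nat_mult simp: le_nat_iff nat_le_iff)
  qed
  then obtain h where h: "\<And>i. i * Suc L \<le> h i" "\<And>i. h i \<le> i * Suc L + L" "\<And>i. int (h i) \<in> E"
    by metis
  have "h i div Suc L = i" for i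
    using h(1,2)[of i] by (intro div_nat_eqI) (auto simp: mult.commute)
  then have "inj_on h {..<M}"
    by (metis inj_onI)
  moreover have "h ` {..<M} \<subseteq> {a. a < M * Suc L \<and> int a \<in> E}"
  proof clarsimp
    fix i assume "i < M"
    then have "Suc i * Suc L \<le> M * Suc L"
      by (intro mult_le_mono1) auto
    then show "h i < M + M * L \<and> int (h i) \<in> E"
      using h[of i] by auto
  qed
  ultimately show ?thesis
    using card_inj_on_le[of h "{..<M}"] by auto
qed

text \<open>The order of quantifiers is the point: the number \<open>K\<close> of terms is fixed
  before the window \<open>N\<close>, and coefficients and frequencies stay in a compact set. This
  is what allows \<open>N\<close> to tend to infinity afterwards.\<close>

lemma almost_periodic_window_approximation:
  fixes f :: "int \<Rightarrow> complex"
  assumes bound: "\<And>n. cmod (f n) \<le> B"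
    and dense: "\<And>m. \<exists>\<tau>\<in>{m..m + int L}. \<forall>n. cmod (f (n + \<tau>) - f n) \<le> \<epsilon>"
    and "\<epsilon> > 0"
  obtains K :: nat where
    "\<And>N. \<exists>c \<theta>. (\<forall>j::nat. cmod (c j) \<le> B \<and> \<bar>\<theta> j\<bar> \<le> 2 * pi) \<and>
       (\<forall>x. \<bar>x\<bar> \<le> int N \<longrightarrow> cmod (f x - (\<Sum>j<K. c j * cis (\<theta> j * of_int x))) \<le> 3 * \<epsilon>)"
proof -
  have B0: "B \<ge> 0"
    using norm_ge_zero[of "f 0"] bound[of 0] by linarith
  \<comment> \<open>\<open>C\<close> will bound \<open>P / card A\<close>, the reciprocal of the
    density of the almost periods in the cyclic group.\<close>
  define C where "C = 4 * real (Suc L)"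
  have C0: "C > 0" by (simp add: C_def)
  \<comment> \<open>Frequencies with \<open>cmod (\<alpha> r)\<close> below \<open>\<eta>\<close>
    are dropped; by Cauchy--Schwarz this costs at most \<open>\<eta> * (B * sqrt C)\<close>. The
    summand 1 in \<open>B + 1\<close> avoids division by zero.\<close>
  define \<eta> where "\<eta> = \<epsilon> / ((B + 1) * sqrt C)"
  have \<eta>: "\<eta> > 0" "\<eta> * (B * sqrt C) \<le> \<epsilon>"
  proof -
    show "\<eta> > 0"
      unfolding \<eta>_def using \<open>\<epsilon> > 0\<close> B0 C0 by (intro divide_pos_pos mult_pos_pos) auto
    have "\<eta> * (B * sqrt C) = \<epsilon> * (B / (B + 1))"
      using C0 by (simp add: \<eta>_def)
    also have "\<dots> \<le> \<epsilon>"
      using \<open>\<epsilon> > 0\<close> B0 by (intro mult_left_le) auto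
    finally show "\<eta> * (B * sqrt C) \<le> \<epsilon>" .
  qed
  \<comment> \<open>Since the squares of the \<open>cmod (\<alpha> r)\<close> will sum to at most
    \<open>C\<close>, no more than \<open>C / \<eta>\<^sup>2\<close> frequencies can reach the
    threshold.\<close>
  define K where "K = nat \<lceil>C / \<eta>\<^sup>2\<rceil>"
  show ?thesis
  proof (rule that[of K])
    fix N0 :: nat
    \<comment> \<open>The window is enlarged to \<open>M\<close> whole blocks of length
      \<open>Suc L\<close>; the successor makes \<open>A\<close> nonempty even when
      \<open>N0 = 0\<close>.\<close>
    define M where "M = Suc N0"
    define N where "N = M * Suc L"
    \<comment> \<open>For \<open>\<bar>x\<bar> \<le> N\<close> and \<open>a\<close>,
      \<open>b\<close> below \<open>N\<close>, the number \<open>x + a - b\<close> lies strictly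
      between \<open>- 2 * N\<close> and \<open>2 * N\<close>. After a shift by \<open>2 * N\<close>
      it is an index below \<open>4 * N\<close>, so nothing wraps around in the cyclic
      group.\<close>
    define P where "P = 4 * N"
    have N: "M \<le> N" "N > 0" "P > 0"
      by (auto simp: N_def P_def M_def)
    define A where "A = {a. a < N \<and> (\<forall>n. cmod (f (n + int a) - f n) \<le> \<epsilon>)}"
    have "M \<le> card A"
      using card_almost_periods[of L "{\<tau>. \<forall>n. cmod (f (n + \<tau>) - f n) \<le> \<epsilon>}" M] dense
      by (simp add: A_def N_def)
    moreover have "real P = C * M"
      by (simp add: P_def C_def N_def algebra_simps)
    ultimately have cA: "card A > 0" "real P \<le> C * card A"
      using C0 by (auto simp: M_def intro: mult_left_mono)
    then have finA: "finite A" by (simp add: card_ge_0_finite)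
    let ?e = "\<lambda>r y. cis (2 * pi * real r * real y / real P)"
    define F where "F y = f (int y - 2 * int N)" for y
    define c where "c r = (\<Sum>x<P. F x * cnj (?e r x)) / P" for r
    define \<alpha> where "\<alpha> r = (\<Sum>a\<in>A. ?e r a) / card A" for r
    have c_norm: "cmod (c r) \<le> B" for r
    proof -
      have "cmod (\<Sum>x<P. F x * cnj (?e r x)) \<le> (\<Sum>x<P. B)"
        by (rule sum_norm_le) (simp add: norm_mult F_def bound)
      then show ?thesis
        using N by (simp add: c_def norm_divide field_simps)
    qed
    have \<alpha>_norm: "cmod (\<alpha> r) \<le> 1" for r
    proof -
      have "cmod (\<Sum>a\<in>A. ?e r a) \<le> (\<Sum>a\<in>A. 1)"
        by (rule sum_norm_le) simp
      then show ?thesis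
        using cA by (simp add: \<alpha>_def norm_divide)
    qed
    \<comment> \<open>Conjugation turns \<open>c r\<close> into a transform of
      \<open>cnj (F y)\<close> with the sign of the exponent used in
      \<open>parseval\<close>.\<close>
    have c_sum: "(\<Sum>r<P. (cmod (c r))\<^sup>2) \<le> B\<^sup>2"
    proof -
      have "cmod (c r) = cmod (\<Sum>y<P. cnj (F y) * ?e r y) / P" for r
      proof -
        have "cnj (c r) = (\<Sum>y<P. cnj (F y) * ?e r y) / P"
          by (simp add: c_def cnj_sum)
        then show ?thesis
          by (metis complex_mod_cnj norm_divide norm_of_nat)
      qed
      then have "(\<Sum>r<P. (cmod (c r))\<^sup>2) = (\<Sum>r<P. (cmod (\<Sum>y<P. cnj (F y) * ?e r y))\<^sup>2) / (real P)\<^sup>2"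
        by (simp add: power_divide sum_divide_distrib)
      also have "\<dots> = (\<Sum>y<P. (cmod (F y))\<^sup>2) / P"
        unfolding parseval using N by (simp add: power2_eq_square)
      also have "\<dots> \<le> (\<Sum>y<P. B\<^sup>2) / P"
        by (intro divide_right_mono sum_mono power_mono) (auto simp: F_def bound)
      finally show ?thesis using N by simp
    qed
    \<comment> \<open>Parseval for the indicator function of \<open>A\<close> evaluates the sum to
      \<open>P / card A\<close>.\<close>
    have \<alpha>_sum: "(\<Sum>r<P. (cmod (\<alpha> r))\<^sup>2) \<le> C"
    proof -
      have AP: "A \<subseteq> {..<P}" by (auto simp: A_def P_def)
      have sumA: "(\<Sum>a\<in>A. ?e r a) = (\<Sum>y<P. of_bool (y \<in> A) * ?e r y)" for r
        using AP by (simp add: of_bool_def if_distrib[of "\<lambda>x. x * _"] sum.If_cases Int_absorb1 cong: if_cong)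
      have absA: "cmod (\<alpha> r) = cmod (\<Sum>y<P. of_bool (y \<in> A) * ?e r y) / card A" for r
        by (simp only: \<alpha>_def sumA norm_divide norm_of_nat)
      have "(\<Sum>r<P. (cmod (\<alpha> r))\<^sup>2) =
          (\<Sum>r<P. (cmod (\<Sum>y<P. of_bool (y \<in> A) * ?e r y))\<^sup>2) / (real (card A))\<^sup>2"
        by (simp only: absA power_divide sum_divide_distrib)
      also have "\<dots> = P * (\<Sum>y<P. (cmod (of_bool (y \<in> A)))\<^sup>2) / (real (card A))\<^sup>2"
        by (simp only: parseval)
      also have "(\<Sum>y<P. (cmod (of_bool (y \<in> A)))\<^sup>2) = card A"
        using AP by (simp add: of_bool_def if_distrib[of cmod] if_distrib[of "\<lambda>x. x\<^sup>2"] sum.If_cases Int_absorb1 cong: if_cong)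
      also have "P * real (card A) / (real (card A))\<^sup>2 = P / card A"
        using cA by (simp add: power2_eq_square)
      also have "\<dots> \<le> C"
        using cA by (simp add: field_simps)
      finally show ?thesis .
    qed
    \<comment> \<open>The final phase undoes the shift by \<open>2 * N\<close> in \<open>F\<close>;
      the factor \<open>(cmod (\<alpha> r))\<^sup>2\<close> is the effect of averaging over the
      differences \<open>a - b\<close>.\<close>
    define d where "d r = c r * of_real ((cmod (\<alpha> r))\<^sup>2) * cis (2 * pi * real r * (2 * real N) / real P)" for r
    define \<theta> where "\<theta> r = 2 * pi * real r / real P" for r
    have d_norm: "cmod (d r) = cmod (c r) * (cmod (\<alpha> r))\<^sup>2" for r
      by (simp add: d_def norm_mult del: of_real_power)
    \<comment> \<open>The mean of \<open>f (x + a - b)\<close> over all \<open>a\<close>,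
      \<open>b\<close> in \<open>A\<close> is computed exactly by Fourier inversion: the double sum
      of phases factors as a transform of \<open>A\<close> times its conjugate. The same mean is
      then compared with \<open>f x\<close>.\<close>
    have average: "cmod (f x - (\<Sum>r<P. d r * cis (\<theta> r * of_int x))) \<le> 2 * \<epsilon>" if x: "\<bar>x\<bar> \<le> int N" for x
    proof -
      have shift: "f (x + int a - int b) =
          (\<Sum>r<P. c r * cis (2 * pi * real r * (2 * real N) / real P) * cis (\<theta> r * of_int x) * (?e r a * cnj (?e r b)))"
        if "a \<in> A" "b \<in> A" for a b
      proof -
        define y where "y = nat (x + int a - int b + 2 * int N)"
        have y: "int y = x + int a - int b + 2 * int N" "y < P"
          using that x by (auto simp: y_def A_def P_def)
        have y': "real y = of_int x + real a - real b + 2 * real N"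
          using arg_cong[OF y(1), of real_of_int] by simp
        have "f (x + int a - int b) = F y"
          using y by (simp add: F_def)
        also have "\<dots> = (\<Sum>r<P. c r * ?e r y)"
          unfolding c_def by (rule dft_inversion[OF y(2)])
        also have "\<dots> = (\<Sum>r<P. c r * cis (2 * pi * real r * (2 * real N) / real P) * cis (\<theta> r * of_int x) * (?e r a * cnj (?e r b)))"
          by (intro sum.cong refl)
            (simp add: y' \<theta>_def cis_cnj cis_mult mult.assoc add_divide_distrib diff_divide_distrib algebra_simps)
        finally show ?thesis .
      qed
      have "(\<Sum>a\<in>A. \<Sum>b\<in>A. f (x + int a - int b)) =
          (\<Sum>a\<in>A. \<Sum>b\<in>A. \<Sum>r<P. c r * cis (2 * pi * real r * (2 * real N) / real P) * cis (\<theta> r * of_int x) * (?e r a * cnj (?e r b)))"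
        by (intro sum.cong refl shift)
      also have "\<dots> = (\<Sum>r<P. \<Sum>a\<in>A. \<Sum>b\<in>A. c r * cis (2 * pi * real r * (2 * real N) / real P) * cis (\<theta> r * of_int x) * (?e r a * cnj (?e r b)))"
        by (rule trans[OF sum.cong[OF refl sum.swap] sum.swap])
      also have "\<dots> = (\<Sum>r<P. c r * cis (2 * pi * real r * (2 * real N) / real P) * cis (\<theta> r * of_int x) *
          ((\<Sum>a\<in>A. ?e r a) * cnj (\<Sum>a\<in>A. ?e r a)))"
        unfolding cnj_sum sum_product by (simp only: sum_distrib_left)
      also have "\<dots> = (\<Sum>r<P. (card A)\<^sup>2 * (d r * cis (\<theta> r * of_int x)))"
      proof (intro sum.cong refl)
        fix r
        have "(\<Sum>a\<in>A. ?e r a) = card A * \<alpha> r"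
          using cA by (simp add: \<alpha>_def)
        then have "(\<Sum>a\<in>A. ?e r a) * cnj (\<Sum>a\<in>A. ?e r a) = (card A)\<^sup>2 * (\<alpha> r * cnj (\<alpha> r))"
          by (simp add: power2_eq_square)
        also have "\<dots> = (card A)\<^sup>2 * complex_of_real ((cmod (\<alpha> r))\<^sup>2)"
          by (simp only: complex_norm_square)
        finally show "c r * cis (2 * pi * real r * (2 * real N) / real P) * cis (\<theta> r * of_int x) *
          ((\<Sum>a\<in>A. ?e r a) * cnj (\<Sum>a\<in>A. ?e r a)) = (card A)\<^sup>2 * (d r * cis (\<theta> r * of_int x))"
          by (simp only: d_def mult_ac)
      qed
      also have "\<dots> = (card A)\<^sup>2 * (\<Sum>r<P. d r * cis (\<theta> r * of_int x))"
        by (simp add: sum_distrib_left)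
      finally have avg: "(\<Sum>a\<in>A. \<Sum>b\<in>A. f (x + int a - int b)) = (card A)\<^sup>2 * (\<Sum>r<P. d r * cis (\<theta> r * of_int x))" .
      have "(card A)\<^sup>2 * (f x - (\<Sum>r<P. d r * cis (\<theta> r * of_int x))) =
          (\<Sum>a\<in>A. \<Sum>b\<in>A. f x - f (x + int a - int b))"
        by (simp add: right_diff_distrib sum_subtractf avg power2_eq_square)
      also have "cmod \<dots> \<le> (\<Sum>a\<in>A. \<Sum>b\<in>A. 2 * \<epsilon>)"
      proof (intro sum_norm_le)
        fix a b assume ab: "a \<in> A" "b \<in> A"
        \<comment> \<open>Both \<open>x + a - b\<close> and \<open>x\<close> are reached from
          \<open>x - b\<close> by an almost period, \<open>a\<close> and \<open>b\<close>
          respectively.\<close>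
        have "cmod (f (x - int b + int a) - f (x - int b)) \<le> \<epsilon>" "cmod (f (x - int b + int b) - f (x - int b)) \<le> \<epsilon>"
          using ab unfolding A_def by blast+
        then show "cmod (f x - f (x + int a - int b)) \<le> 2 * \<epsilon>"
          using norm_triangle_ineq4[of "f (x - int b + int b) - f (x - int b)" "f (x - int b + int a) - f (x - int b)"]
          by (simp add: algebra_simps)
      qed
      finally have "(real (card A))\<^sup>2 * cmod (f x - (\<Sum>r<P. d r * cis (\<theta> r * of_int x))) \<le> (real (card A))\<^sup>2 * (2 * \<epsilon>)"
        by (simp add: norm_mult norm_power power2_eq_square)
      then show ?thesis
        using cA by simp
    qed
    define R where "R = {r. r < P \<and> \<eta> \<le> cmod (\<alpha> r)}"
    have R: "finite R" "R \<subseteq> {..<P}" by (auto simp: R_def)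
    have "card R \<le> K"
    proof -
      have "card R * \<eta>\<^sup>2 = (\<Sum>r\<in>R. \<eta>\<^sup>2)" by simp
      also have "\<dots> \<le> (\<Sum>r\<in>R. (cmod (\<alpha> r))\<^sup>2)"
        using \<eta> by (intro sum_mono power_mono) (auto simp: R_def)
      also have "\<dots> \<le> (\<Sum>r<P. (cmod (\<alpha> r))\<^sup>2)"
        using R by (intro sum_mono2) auto
      also have "\<dots> \<le> C" by (rule \<alpha>_sum)
      finally have "real (card R) \<le> C / \<eta>\<^sup>2"
        using \<eta> by (simp add: field_simps)
      then show ?thesis
        unfolding K_def by linarith
    qed
    \<comment> \<open>Off \<open>R\<close> one factor \<open>cmod (\<alpha> r)\<close> is estimated
      by \<open>\<eta>\<close>; the other is kept and paired with \<open>cmod (c r)\<close> by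
      Cauchy--Schwarz, so the number of dropped terms does not matter.\<close>
    have tail: "cmod ((\<Sum>r<P. d r * cis (\<theta> r * of_int x)) - (\<Sum>r\<in>R. d r * cis (\<theta> r * of_int x))) \<le> \<epsilon>" for x :: int
    proof -
      have "(\<Sum>r<P. d r * cis (\<theta> r * of_int x)) - (\<Sum>r\<in>R. d r * cis (\<theta> r * of_int x)) =
          (\<Sum>r\<in>{..<P} - R. d r * cis (\<theta> r * of_int x))"
        using R by (simp add: sum_diff)
      also have "cmod \<dots> \<le> (\<Sum>r\<in>{..<P} - R. \<eta> * (cmod (c r) * cmod (\<alpha> r)))"
      proof (rule sum_norm_le)
        fix r assume "r \<in> {..<P} - R"
        then have "cmod (\<alpha> r) \<le> \<eta>" by (auto simp: R_def)
        then have "cmod (\<alpha> r) * (cmod (c r) * cmod (\<alpha> r)) \<le> \<eta> * (cmod (c r) * cmod (\<alpha> r))"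
          by (intro mult_right_mono) auto
        then show "cmod (d r * cis (\<theta> r * of_int x)) \<le> \<eta> * (cmod (c r) * cmod (\<alpha> r))"
          by (simp add: norm_mult d_norm power2_eq_square mult_ac)
      qed
      also have "\<dots> \<le> \<eta> * (\<Sum>r<P. cmod (c r) * cmod (\<alpha> r))"
        unfolding sum_distrib_left using \<eta> by (intro sum_mono2) auto
      also have "\<dots> \<le> \<eta> * (B * sqrt C)"
      proof (rule mult_left_mono)
        have "(\<Sum>r<P. cmod (c r) * cmod (\<alpha> r)) \<le> L2_set (\<lambda>r. cmod (c r)) {..<P} * L2_set (\<lambda>r. cmod (\<alpha> r)) {..<P}"
          using L2_set_mult_ineq[of "\<lambda>r. cmod (c r)" "\<lambda>r. cmod (\<alpha> r)" "{..<P}"] by simp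
        also have "\<dots> \<le> B * sqrt C"
          using c_sum \<alpha>_sum B0 unfolding L2_set_def
          by (intro mult_mono real_sqrt_le_mono real_le_lsqrt) (auto intro: sum_nonneg)
        finally show "(\<Sum>r<P. cmod (c r) * cmod (\<alpha> r)) \<le> B * sqrt C" .
      qed (use \<eta> in auto)
      also have "\<dots> \<le> \<epsilon>" by (rule \<eta>)
      finally show ?thesis .
    qed
    \<comment> \<open>\<open>R\<close> is renumbered by an initial segment and padded with zero
      terms up to \<open>K\<close>, so that the shape of the sum no longer depends on
      \<open>N0\<close>.\<close>
    obtain h where h: "bij_betw h {..<card R} R"
      using ex_bij_betw_nat_finite[OF R(1)] by (auto simp: atLeast0LessThan)
    define c' where "c' j = (if j < card R then d (h j) else 0)" for j
    define \<theta>' where "\<theta>' j = (if j < card R then \<theta> (h j) else 0)" for j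
    have "cmod (d r) \<le> B * 1" for r
      unfolding d_norm using B0 by (intro mult_mono c_norm power_le_one \<alpha>_norm) auto
    then have "cmod (c' j) \<le> B" for j
      using B0 by (simp add: c'_def)
    moreover have "\<bar>\<theta>' j\<bar> \<le> 2 * pi" for j
    proof (cases "j < card R")
      case True
      then have "h j \<in> R" using h by (auto simp: bij_betw_def)
      then have "real (h j) \<le> P" by (auto simp: R_def)
      then show ?thesis using N True by (simp add: \<theta>'_def \<theta>_def abs_mult field_simps)
    qed (simp add: \<theta>'_def)
    moreover have "cmod (f x - (\<Sum>j<K. c' j * cis (\<theta>' j * of_int x))) \<le> 3 * \<epsilon>" if "\<bar>x\<bar> \<le> int N0" for x
    proof -
      have "(\<Sum>j<K. c' j * cis (\<theta>' j * of_int x)) = (\<Sum>j<card R. c' j * cis (\<theta>' j * of_int x))"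
        using \<open>card R \<le> K\<close> by (intro sum.mono_neutral_right) (auto simp: c'_def)
      also have "\<dots> = (\<Sum>j<card R. d (h j) * cis (\<theta> (h j) * of_int x))"
        by (intro sum.cong) (auto simp: c'_def \<theta>'_def)
      also have "\<dots> = (\<Sum>r\<in>R. d r * cis (\<theta> r * of_int x))"
        using sum.reindex_bij_betw[OF h] .
      finally have eq: "(\<Sum>j<K. c' j * cis (\<theta>' j * of_int x)) = (\<Sum>r\<in>R. d r * cis (\<theta> r * of_int x))" .
      have "\<bar>x\<bar> \<le> int N"
        using that N by (simp add: M_def)
      from norm_diff_triangle_le[OF average[OF this] tail[of x]] show ?thesis
        by (simp add: eq)
    qed
    ultimately show "\<exists>c \<theta>. (\<forall>j::nat. cmod (c j) \<le> B \<and> \<bar>\<theta> j\<bar> \<le> 2 * pi) \<and>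
       (\<forall>x. \<bar>x\<bar> \<le> int N0 \<longrightarrow> cmod (f x - (\<Sum>j<K. c j * cis (\<theta> j * of_int x))) \<le> 3 * \<epsilon>)"
      by blast
  qed
qed

text \<open>By compactness all coefficients and frequencies converge along one common subsequence of
  windows. A fixed \<open>x\<close> lies in all later windows, so the weak inequality passes to the
  limit.\<close>

lemma almost_periodic_int_approximation:
  fixes f :: "int \<Rightarrow> complex"
  assumes bound: "\<And>n. cmod (f n) \<le> B"
    and dense: "\<And>m. \<exists>\<tau>\<in>{m..m + int L}. \<forall>n. cmod (f (n + \<tau>) - f n) \<le> \<epsilon>"
    and "\<epsilon> > 0"
  obtains K :: nat and c \<theta>
  where "\<And>x. cmod (f x - (\<Sum>j<K. c j * cis (\<theta> j * of_int x))) \<le> 3 * \<epsilon>"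
proof -
  obtain K where K: "\<And>N. \<exists>c \<theta>. (\<forall>j::nat. cmod (c j) \<le> B \<and> \<bar>\<theta> j\<bar> \<le> 2 * pi) \<and>
       (\<forall>x. \<bar>x\<bar> \<le> int N \<longrightarrow> cmod (f x - (\<Sum>j<K. c j * cis (\<theta> j * of_int x))) \<le> 3 * \<epsilon>)"
    using assms by (rule almost_periodic_window_approximation) (rule that)
  define Q where "Q N c \<theta> \<longleftrightarrow> (\<forall>j::nat. cmod (c j) \<le> B \<and> \<bar>\<theta> j\<bar> \<le> 2 * pi) \<and>
       (\<forall>x. \<bar>x\<bar> \<le> int N \<longrightarrow> cmod (f x - (\<Sum>j<K. c j * cis (\<theta> j * of_int x))) \<le> 3 * \<epsilon>)" for N c \<theta>
  have "\<forall>N. \<exists>c \<theta>. Q N c \<theta>"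
    unfolding Q_def using K by blast
  then obtain c \<theta> where "\<And>N. Q N (c N) (\<theta> N)"
    by metis
  then have c\<theta>: "\<And>N j::nat. cmod (c N j) \<le> B" "\<And>N j. \<bar>\<theta> N j\<bar> \<le> 2 * pi"
      "\<And>N x. \<bar>x\<bar> \<le> int N \<Longrightarrow> cmod (f x - (\<Sum>j<K. c N j * cis (\<theta> N j * of_int x))) \<le> 3 * \<epsilon>"
    unfolding Q_def by blast+
  have bnd: "norm (c N j, \<theta> N j) \<le> B + 2 * pi" for N j
    using norm_Pair_le[of "c N j" "\<theta> N j"] c\<theta>(1,2)[of N j] by simp
  obtain k :: "nat \<Rightarrow> nat" where k: "strict_mono k" "\<And>j. \<exists>l. (\<lambda>N. (c (k N) j, \<theta> (k N) j)) \<longlonglongrightarrow> l"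
    using function_convergent_subsequence[of UNIV "\<lambda>N j. (c N j, \<theta> N j)", OF _ bnd] by auto
  then obtain l where l: "\<And>j. (\<lambda>N. (c (k N) j, \<theta> (k N) j)) \<longlonglongrightarrow> l j"
    by metis
  show ?thesis
  proof (rule that[where K = K and c = "fst \<circ> l" and \<theta> = "snd \<circ> l"])
    fix x :: int
    have lim: "(\<lambda>N. c (k N) j) \<longlonglongrightarrow> fst (l j)" "(\<lambda>N. \<theta> (k N) j) \<longlonglongrightarrow> snd (l j)" for j
      using tendsto_fst[OF l[of j]] tendsto_snd[OF l[of j]] by simp_all
    have "(\<lambda>N. cis (\<theta> (k N) j * of_int x)) \<longlonglongrightarrow> cis (snd (l j) * of_int x)" for j
      unfolding cis_conv_exp by (intro tendsto_intros lim)
    then have conv: "(\<lambda>N. cmod (f x - (\<Sum>j<K. c (k N) j * cis (\<theta> (k N) j * of_int x))))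
        \<longlonglongrightarrow> cmod (f x - (\<Sum>j<K. fst (l j) * cis (snd (l j) * of_int x)))"
      by (intro tendsto_intros lim)
    \<comment> \<open>A strictly increasing \<open>k\<close> satisfies \<open>k N \<ge> N\<close>,
      so the window with index \<open>k N\<close> contains \<open>x\<close>.\<close>
    have le: "cmod (f x - (\<Sum>j<K. c (k N) j * cis (\<theta> (k N) j * of_int x))) \<le> 3 * \<epsilon>"
      if "N \<ge> nat \<bar>x\<bar>" for N
      using that seq_suble[OF k(1), of N] by (intro c\<theta>(3)) linarith
    show "cmod (f x - (\<Sum>j<K. (fst \<circ> l) j * cis ((snd \<circ> l) j * of_int x))) \<le> 3 * \<epsilon>"
      unfolding o_def by (rule LIMSEQ_le_const2[OF conv]) (use le in blast)
  qed
qed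

section \<open>Boundedness and uniform continuity of almost periodic functions\<close>

lemma almost_periodicD:
  assumes "almost_periodic f" "\<epsilon> > 0"
  shows "\<exists>l>0. \<forall>t0. \<exists>\<tau>\<in>{t0..t0 + l}. \<forall>t. cmod (f t - f (t + \<tau>)) < \<epsilon>"
  using assms by (simp add: almost_periodic_def)

text \<open>An almost period carries any \<open>t\<close> into the compact interval
  \<open>{0..l}\<close> at the cost of changing the value by less than 1.\<close>

lemma almost_periodic_bounded:
  assumes "almost_periodic f"
  obtains B where "\<And>t. cmod (f t) \<le> B"
proof -
  have cont: "continuous_on UNIV f"
    using assms by (simp add: almost_periodic_def)
  obtain l where l: "l > 0" "\<And>t0. \<exists>\<tau>\<in>{t0..t0 + l}. \<forall>t. cmod (f t - f (t + \<tau>)) < 1"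
    using almost_periodicD[OF assms zero_less_one] by blast
  have "compact (f ` {0..l})"
    by (intro compact_continuous_image continuous_on_subset[OF cont]) auto
  then have "bounded (f ` {0..l})"
    by (rule compact_imp_bounded)
  then obtain B where "\<forall>z\<in>f ` {0..l}. cmod z \<le> B"
    unfolding bounded_iff by blast
  then have B: "\<And>t. t \<in> {0..l} \<Longrightarrow> cmod (f t) \<le> B"
    by simp
  have "cmod (f t) \<le> B + 1" for t
  proof -
    obtain \<tau> where \<tau>: "\<tau> \<in> {-t..-t + l}" "cmod (f t - f (t + \<tau>)) < 1"
      using l(2) by blast
    then have "t + \<tau> \<in> {0..l}" by auto
    from B[OF this] \<tau>(2) show ?thesis
      using norm_triangle_sub[of "f t" "f (t + \<tau>)"] by linarith
  qed
  then show ?thesis by (rule that)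
qed

text \<open>An almost period carries \<open>s\<close> into \<open>{0..l}\<close>, and
  \<open>t\<close>, being at distance less than 1, into \<open>{-1..l+1}\<close>. Uniform continuity
  on this compact interval then suffices.\<close>

lemma almost_periodic_uniformly_continuous:
  assumes "almost_periodic f" "\<epsilon> > 0"
  obtains d where "d > 0" "\<And>s t. \<bar>s - t\<bar> < d \<Longrightarrow> cmod (f s - f t) < \<epsilon>"
proof -
  have cont: "continuous_on UNIV f"
    using assms by (simp add: almost_periodic_def)
  have e3: "\<epsilon>/3 > 0" using assms by simp
  obtain l where l: "l > 0" "\<And>t0. \<exists>\<tau>\<in>{t0..t0 + l}. \<forall>t. cmod (f t - f (t + \<tau>)) < \<epsilon>/3"
    using almost_periodicD[OF assms(1) e3] by blast
  have "uniformly_continuous_on {-1..l+1} f"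
    by (intro compact_uniformly_continuous continuous_on_subset[OF cont]) auto
  then have "\<exists>d>0. \<forall>s\<in>{-1..l+1}. \<forall>t\<in>{-1..l+1}. dist t s < d \<longrightarrow> dist (f t) (f s) < \<epsilon>/3"
    unfolding uniformly_continuous_on_def using e3 by blast
  then obtain d where d: "d > 0" "\<forall>s\<in>{-1..l+1}. \<forall>t\<in>{-1..l+1}. dist t s < d \<longrightarrow> dist (f t) (f s) < \<epsilon>/3"
    by blast
  show ?thesis
  proof (rule that[of "min d 1"])
    fix s t :: real assume st: "\<bar>s - t\<bar> < min d 1"
    obtain \<tau> where \<tau>: "\<tau> \<in> {-s..-s + l}" "\<And>t. cmod (f t - f (t + \<tau>)) < \<epsilon>/3"
      using l(2) by blast
    have "s + \<tau> \<in> {-1..l+1}" "t + \<tau> \<in> {-1..l+1}"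
      using \<tau>(1) st unfolding atLeastAtMost_iff by linarith+
    then have "cmod (f (s + \<tau>) - f (t + \<tau>)) < \<epsilon>/3"
      using d(2)[rule_format, of "t + \<tau>" "s + \<tau>"] st by (simp add: dist_norm)
    moreover have "cmod (f s - f t) \<le> cmod (f s - f (s + \<tau>)) + cmod (f (s + \<tau>) - f (t + \<tau>)) + cmod (f t - f (t + \<tau>))"
      using norm_triangle_ineq[of "f s - f (s + \<tau>)" "f (s + \<tau>) - f (t + \<tau>)"]
        norm_triangle_ineq4[of "f s - f (t + \<tau>)" "f t - f (t + \<tau>)"] by simp
    ultimately show "cmod (f s - f t) < \<epsilon>"
      using \<tau>(2)[of s] \<tau>(2)[of t] by linarith
  qed (use d in auto)
qed

section \<open>Piecewise linear interpolation and passage to the real line\<close>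

definition interpolate :: "(int \<Rightarrow> complex) \<Rightarrow> real \<Rightarrow> complex" where
  "interpolate a t = of_real (1 - frac t) * a \<lfloor>t\<rfloor> + of_real (frac t) * a (\<lfloor>t\<rfloor> + 1)"

text \<open>One formula that is valid on both sides of an integer, where the definition through
  \<open>floor\<close> changes its branch; continuity there becomes immediate.\<close>

lemma interpolate_near:
  assumes "of_int n - 1 < t" "t < of_int n + 1"
  shows "interpolate a t =
    a n + of_real (max 0 (t - of_int n)) * (a (n + 1) - a n) + of_real (max 0 (of_int n - t)) * (a (n - 1) - a n)"
proof (cases "of_int n \<le> t")
  case True
  then have "\<lfloor>t\<rfloor> = n" using assms by (simp add: floor_eq_iff)
  then show ?thesis using True
    by (simp add: interpolate_def frac_def max_def algebra_simps)
next
  case False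
  then have *: "\<lfloor>t\<rfloor> = n - 1" using assms by (simp add: floor_eq_iff)
  show ?thesis using False
    by (simp add: interpolate_def frac_def * max_def algebra_simps)
qed

lemma continuous_on_interpolate: "continuous_on X (interpolate a)"
proof (intro continuous_at_imp_continuous_on ballI)
  fix t :: real
  define n where "n = \<lfloor>t\<rfloor>"
  let ?g = "\<lambda>t. a n + of_real (max 0 (t - of_int n)) * (a (n + 1) - a n) + of_real (max 0 (of_int n - t)) * (a (n - 1) - a n)"
  have "t \<in> {of_int n - 1<..<of_int n + 1}"
    unfolding n_def greaterThanLessThan_iff by linarith
  then have "\<forall>\<^sub>F s in nhds t. s \<in> {of_int n - 1<..<of_int n + 1}"
    by (intro eventually_nhds_in_open) auto
  then have ev: "\<forall>\<^sub>F s in nhds t. ?g s = interpolate a s"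
    by (rule eventually_mono) (simp add: interpolate_near[of n])
  have "isCont ?g t"
    by (intro continuous_intros)
  then show "isCont (interpolate a) t"
    by (rule iffD1[OF isCont_cong[OF ev]])
qed

text \<open>The interpolant is a convex combination of the two neighbouring values.\<close>

lemma norm_diff_interpolate_le:
  assumes "cmod (z - a \<lfloor>t\<rfloor>) \<le> \<epsilon>" "cmod (z - a (\<lfloor>t\<rfloor> + 1)) \<le> \<epsilon>"
  shows "cmod (z - interpolate a t) \<le> \<epsilon>"
proof -
  have fr: "0 \<le> frac t" "frac t \<le> 1"
    using frac_ge_0[of t] frac_lt_1[of t] by auto
  have "z - interpolate a t = of_real (1 - frac t) * (z - a \<lfloor>t\<rfloor>) + of_real (frac t) * (z - a (\<lfloor>t\<rfloor> + 1))"
    by (simp add: interpolate_def algebra_simps)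
  also have "cmod \<dots> \<le> (1 - frac t) * cmod (z - a \<lfloor>t\<rfloor>) + frac t * cmod (z - a (\<lfloor>t\<rfloor> + 1))"
    using fr norm_triangle_ineq[of "of_real (1 - frac t) * (z - a \<lfloor>t\<rfloor>)" "of_real (frac t) * (z - a (\<lfloor>t\<rfloor> + 1))"]
    by (simp only: norm_mult norm_of_real)
  also have "\<dots> \<le> (1 - frac t) * \<epsilon> + frac t * \<epsilon>"
    using fr assms by (intro add_mono mult_left_mono) auto
  finally show ?thesis by (simp add: algebra_simps)
qed

lemma trig_limit_affine:
  assumes "trig_limit f"
  shows "trig_limit (\<lambda>t. f (a * t + b))"
  unfolding trig_limit_def
proof (intro allI impI)
  fix \<epsilon> :: real assume "\<epsilon> > 0"
  then obtain P where "P \<in> trig_polys" "\<forall>t. cmod (f t - P t) < \<epsilon>"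
    using assms unfolding trig_limit_def by blast
  then show "\<exists>P\<in>trig_polys. \<forall>t. cmod (f (a * t + b) - P t) < \<epsilon>"
    by (intro bexI[of _ "\<lambda>t. P (a * t + b)"] trig_polys_affine) auto
qed

text \<open>A shift by 1 multiplies this interpolant by \<open>cis \<theta>\<close>. Dividing by
  \<open>cis (\<theta> * t)\<close> therefore leaves a continuous function \<open>q\<close> of
  period 1, and the periodic case applies after rescaling.\<close>

lemma trig_limit_interpolate_cis: "trig_limit (interpolate (\<lambda>n. cis (\<theta> * of_int n)))"
proof -
  let ?a = "\<lambda>n. cis (\<theta> * of_int n)"
  define q where "q t = cis (- \<theta> * t) * interpolate ?a t" for t
  have "q (t + 1) = q t" for t
  proof -
    have step: "cis (\<theta> * of_int (n + 1)) = cis \<theta> * cis (\<theta> * of_int n)" for n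
      by (simp add: cis_mult algebra_simps)
    have floor: "\<lfloor>t + 1\<rfloor> = \<lfloor>t\<rfloor> + 1" by simp
    have "interpolate ?a (t + 1) = cis \<theta> * interpolate ?a t"
      unfolding interpolate_def frac_1_eq floor step by (simp add: algebra_simps)
    moreover have "cis (- \<theta> * (t + 1)) * cis \<theta> = cis (- \<theta> * t)"
      by (simp add: cis_mult algebra_simps)
    ultimately show ?thesis
      unfolding q_def by (metis mult.assoc)
  qed
  then have "q (1 / (2 * pi) * (t + 2 * pi) + 0) = q (1 / (2 * pi) * t + 0)" for t
    by (simp add: add_divide_distrib)
  moreover have "continuous_on X q" for X
    unfolding q_def by (intro continuous_intros continuous_on_interpolate)
  then have "continuous_on UNIV (\<lambda>t. q (1 / (2 * pi) * t + 0))"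
    by (rule continuous_on_compose2[of UNIV]) (auto intro!: continuous_intros)
  ultimately have "trig_limit (\<lambda>t. q (1 / (2 * pi) * t + 0))"
    by (intro periodic_trig_limit)
  then have "trig_limit (\<lambda>t. q (1 / (2 * pi) * (2 * pi * t + 0) + 0))"
    by (rule trig_limit_affine)
  then have "trig_limit q" by simp
  then have "trig_limit (\<lambda>t. (1 * cis (\<theta> * t)) * q t)"
    by (intro trig_limit_mult_poly trig_polys.monomial)
  moreover have "(1 * cis (\<theta> * t)) * q t = interpolate ?a t" for t
    by (simp add: q_def cis_mult flip: mult.assoc)
  ultimately show ?thesis by simp
qed

text \<open>Samples of \<open>f\<close> on a grid finer than its modulus of continuity form an
  almost periodic sequence. Its exponential-sum approximant is interpolated linearly and
  rescaled.\<close>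

theorem almost_periodic_trig_limit:
  assumes "almost_periodic f"
  shows "trig_limit f"
proof (rule trig_limit_limit)
  fix \<epsilon> :: real assume "\<epsilon> > 0"
  \<comment> \<open>Sampling costs \<open>e\<close> and the sequence approximation
    \<open>3 * (2 * e)\<close>, since the samples have \<open>2 * e\<close>-almost periods: seven in
    all.\<close>
  define e where "e = \<epsilon> / 7"
  have e: "e > 0" "2 * e > 0" using \<open>\<epsilon> > 0\<close> by (auto simp: e_def)
  obtain B where B: "\<And>t. cmod (f t) \<le> B"
    using assms by (rule almost_periodic_bounded) (rule that)
  obtain d where d: "d > 0" "\<And>s t. \<bar>s - t\<bar> < d \<Longrightarrow> cmod (f s - f t) < e"
    using assms e(1) by (rule almost_periodic_uniformly_continuous) (rule that)
  obtain l where l: "l > 0" "\<And>t0. \<exists>\<tau>\<in>{t0..t0 + l}. \<forall>t. cmod (f t - f (t + \<tau>)) < e"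
    using almost_periodicD[OF assms e(1)] by blast
  define h where "h = d / 2"
  have h: "h > 0" "h < d" using d by (auto simp: h_def)
  define a where "a n = f (of_int n * h)" for n :: int
  \<comment> \<open>\<open>L\<close> must exceed \<open>l / h\<close> by at least one, because the
    real window below starts at \<open>(m + 1) * h\<close>.\<close>
  define L where "L = nat \<lceil>l / h\<rceil> + 2"
  have L: "l / h + 1 \<le> real L"
    unfolding L_def by linarith
  have dense: "\<exists>\<tau>\<in>{m..m + int L}. \<forall>n. cmod (a (n + \<tau>) - a n) \<le> 2 * e" for m
  proof -
    obtain \<tau> where \<tau>: "of_int (m + 1) * h \<le> \<tau>" "\<tau> \<le> of_int (m + 1) * h + l"
      "\<And>t. cmod (f t - f (t + \<tau>)) < e"
      using l(2)[of "of_int (m + 1) * h"] by auto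
    \<comment> \<open>Rounding the real almost period to the grid moves it by less than
      \<open>h < d\<close>, so uniform continuity adds only another \<open>e\<close>.\<close>
    define k where "k = \<lfloor>\<tau> / h\<rfloor>"
    have k: "of_int k \<le> \<tau> / h" "\<tau> / h < of_int k + 1"
      unfolding k_def by linarith+
    then have k': "\<bar>\<tau> - of_int k * h\<bar> < d"
      using h by (simp add: field_simps abs_if)
    have "of_int (m + 1) \<le> \<tau> / h" "\<tau> / h \<le> of_int (m + 1) + l / h"
      using \<tau> h by (simp_all add: field_simps)
    then have "k \<in> {m..m + int L}"
    proof -
      have "real_of_int m \<le> k" "real_of_int k \<le> m + int L"
        using k \<open>of_int (m + 1) \<le> \<tau> / h\<close> \<open>\<tau> / h \<le> of_int (m + 1) + l / h\<close> L by simp_all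
      then show ?thesis by auto
    qed
    moreover have "cmod (a (n + k) - a n) \<le> 2 * e" for n
    proof -
      have "cmod (f (of_int n * h + \<tau>) - f (of_int (n + k) * h)) < e"
        by (rule d(2)) (use k' in \<open>simp add: algebra_simps\<close>)
      moreover have "cmod (f (of_int n * h) - f (of_int n * h + \<tau>)) < e"
        by (rule \<tau>(3))
      ultimately show ?thesis
        using norm_triangle_ineq[of "f (of_int n * h) - f (of_int n * h + \<tau>)" "f (of_int n * h + \<tau>) - f (of_int (n + k) * h)"]
          norm_minus_commute[of "a (n + k)" "a n"]
        by (simp add: a_def)
    qed
    ultimately show ?thesis by blast
  qed
  have "cmod (a n) \<le> B" for n
    by (simp add: a_def B)
  from this dense e(2) obtain K :: nat and c \<theta> where K: "\<And>n. cmod (a n - (\<Sum>j<K. c j * cis (\<theta> j * of_int n))) \<le> 3 * (2 * e)"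
    by (rule almost_periodic_int_approximation) (rule that)
  define Q where "Q n = (\<Sum>j<K. c j * cis (\<theta> j * of_int n))" for n :: int
  have "interpolate Q = (\<lambda>t. \<Sum>j<K. c j * interpolate (\<lambda>n. cis (\<theta> j * of_int n)) t)"
    by (simp add: fun_eq_iff interpolate_def Q_def sum_distrib_left distrib_left sum.distrib mult_ac)
  moreover have "trig_limit (\<lambda>t. \<Sum>j<K. c j * interpolate (\<lambda>n. cis (\<theta> j * of_int n)) t)"
    by (intro trig_limit_sum trig_limit_mult_poly trig_limit_interpolate_cis trig_polys_const) auto
  ultimately have "trig_limit (interpolate Q)"
    by simp
  then have "trig_limit (\<lambda>t. interpolate Q (1 / h * t + 0))"
    by (rule trig_limit_affine)
  moreover have "cmod (f t - interpolate Q (1 / h * t + 0)) \<le> \<epsilon>" for t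
  proof (rule norm_diff_interpolate_le)
    have *: "cmod (f t - Q n) \<le> \<epsilon>" if "\<bar>t - of_int n * h\<bar> \<le> h" for n
    proof -
      have "cmod (f t - a n) < e"
        unfolding a_def by (rule d(2)) (use that h in linarith)
      then show ?thesis
        using norm_triangle_ineq[of "f t - a n" "a n - Q n"] K[of n] unfolding Q_def e_def by simp
    qed
    define n where "n = \<lfloor>1 / h * t + 0\<rfloor>"
    have "of_int n \<le> 1 / h * t + 0" "1 / h * t + 0 < of_int n + 1"
      unfolding n_def by linarith+
    then have "\<bar>t - of_int n * h\<bar> \<le> h" "\<bar>t - of_int (n + 1) * h\<bar> \<le> h"
      using h by (auto simp: field_simps abs_if)
    then show "cmod (f t - Q \<lfloor>1 / h * t + 0\<rfloor>) \<le> \<epsilon>" "cmod (f t - Q (\<lfloor>1 / h * t + 0\<rfloor> + 1)) \<le> \<epsilon>"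
      unfolding n_def[symmetric] by (auto intro: *)
  qed
  ultimately show "\<exists>h. trig_limit h \<and> (\<forall>t. cmod (f t - h t) \<le> \<epsilon>)"
    by (intro exI[of _ "\<lambda>t. interpolate Q (1 / h * t + 0)"] conjI allI)
qed

section \<open>Arc length measure and arc coordinates\<close>

lemma AE_circle_measureD:
  assumes "AE z in circle_measure. P z"
  shows "AE t in lborel. t \<in> {0..<2*pi} \<longrightarrow> P (cis t)"
proof -
  have "AE z in distr (lebesgue_on {0..<2*pi}) (restrict_space borel (sphere 0 1)) cis. P z"
    using assms unfolding circle_measure_def AE_completion_iff .
  then have "AE t in lebesgue_on {0..<2*pi}. P (cis t)"
    by (rule AE_distrD[OF cis_measurable_circle])
  then show ?thesis
    by (simp add: AE_restrict_space_iff AE_completion_iff)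
qed

lemma AE_circle_neq: "AE z in circle_measure. z \<noteq> c"
proof -
  have "AE t in lborel. t \<noteq> Arg2pi c"
    by (rule AE_lborel_singleton)
  then have "AE t in lborel. t \<in> {0..<2*pi} \<longrightarrow> cis t \<noteq> c"
    by (rule AE_mp) (auto intro!: AE_I2 simp: Arg2pi_exp cis_conv_exp)
  then have "AE t in lebesgue_on {0..<2*pi}. cis t \<noteq> c"
    by (simp add: AE_restrict_space_iff AE_completion_iff)
  moreover have "{z \<in> space (restrict_space borel (sphere 0 1)). z \<noteq> c} \<in> sets (restrict_space borel (sphere (0::complex) 1))"
    by (auto simp: space_restrict_space sets_restrict_space intro!: image_eqI[of _ _ "- {c}"])
  ultimately have "AE z in distr (lebesgue_on {0..<2*pi}) (restrict_space borel (sphere 0 1)) cis. z \<noteq> c"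
    by (subst AE_distr_iff[OF cis_measurable_circle])
  then show ?thesis
    unfolding circle_measure_def AE_completion_iff .
qed

lemma AE_circle_not_in_finite:
  assumes "finite X"
  shows "AE z in circle_measure. z \<notin> X"
proof -
  have "AE z in circle_measure. \<forall>x\<in>X. z \<noteq> x"
    using assms by (intro eventually_ball_finite ballI AE_circle_neq)
  then show ?thesis
    by (rule eventually_mono) auto
qed

lemma AE_circle_in_sphere: "AE z in circle_measure. z \<in> sphere 0 1"
  using AE_space[of circle_measure] by (simp only: space_circle_measure)

text \<open>Extension by zero from the relatively open part is Borel measurable, and the values at
  the finitely many exceptional points are restored by multiples of indicators.\<close>

lemma measurable_circle_continuous_off_finite:
  fixes f :: "complex \<Rightarrow> 'b::{real_normed_vector, second_countable_topology}"
  assumes "finite X" "continuous_on (sphere 0 1 - X) f"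
  shows "f \<in> borel_measurable circle_measure"
proof -
  define f' where "f' z = (if z \<in> sphere 0 1 - X then f z else 0)" for z
  have "sphere 0 1 - X \<in> sets borel"
    using finite_imp_closed[OF assms(1)] by (intro sets.Diff borel_closed) auto
  then have f': "f' \<in> borel_measurable borel"
    unfolding f'_def using assms(2) by (intro borel_measurable_continuous_on_if) auto
  have "(\<lambda>z. f' z + (\<Sum>x\<in>X. indicator {x} z *\<^sub>R f x)) \<in> borel_measurable borel"
    by (intro borel_measurable_add f' borel_measurable_sum borel_measurable_scaleR borel_measurable_indicator) auto
  then have "(\<lambda>z. f' z + (\<Sum>x\<in>X. indicator {x} z *\<^sub>R f x)) \<in> borel_measurable (restrict_space borel (sphere 0 1))"
    by (rule measurable_restrict_space1)
  moreover have "f' z + (\<Sum>x\<in>X. indicator {x} z *\<^sub>R f x) = f z" if "z \<in> sphere 0 1" for z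
  proof (cases "z \<in> X")
    case True
    have "(\<Sum>x\<in>X. indicator {x} z *\<^sub>R f x) = (\<Sum>x\<in>X. if x = z then f x else 0)"
      by (intro sum.cong) (auto simp: indicator_def)
    then show ?thesis using True assms(1) by (simp add: f'_def)
  next
    case False
    then have "(\<Sum>x\<in>X. indicator {x} z *\<^sub>R f x) = 0"
      by (intro sum.neutral) (auto simp: indicator_def)
    then show ?thesis using False that by (simp add: f'_def)
  qed
  ultimately have "f \<in> borel_measurable (restrict_space borel (sphere 0 1))"
    by (subst (asm) measurable_cong[of _ _ f]) (auto simp: space_restrict_space)
  then show ?thesis
    unfolding circle_measure_def by (intro measurable_completion) simp
qed

text \<open>A violation at one point off \<open>S\<close> persists on a whole interval of angles,
  which has positive length. The interval is taken to the right of \<open>t0\<close>, which stays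
  inside \<open>{0..<2*pi}\<close> even for \<open>t0 = 0\<close>.\<close>

lemma AE_circle_continuous_norm_le:
  fixes h :: "complex \<Rightarrow> complex"
  assumes "closed S" "continuous_on (sphere 0 1 - S) h"
    and ae: "AE z in circle_measure. z \<notin> S \<longrightarrow> cmod (h z) \<le> c"
    and z: "z \<in> sphere 0 1 - S"
  shows "cmod (h z) \<le> c"
proof (rule ccontr)
  assume "\<not> cmod (h z) \<le> c"
  then have gt: "c < cmod (h z)" by simp
  define t0 where "t0 = Arg2pi z"
  have t0: "0 \<le> t0" "t0 < 2*pi" "cis t0 = z"
    using z Arg2pi[of z] by (auto simp: t0_def cis_Arg2pi_unit)
  have lim: "(cis \<longlongrightarrow> z) (at_right t0)"
    unfolding t0(3)[symmetric] cis_conv_exp by (intro tendsto_intros)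
  have "\<forall>\<^sub>F t in at_right t0. cis t \<in> - S"
    using lim assms(1) z by (intro topological_tendstoD) auto
  then have evS: "\<forall>\<^sub>F t in at_right t0. cis t \<in> sphere 0 1 - S"
    by (rule eventually_mono) simp
  have "((\<lambda>t. h (cis t)) \<longlongrightarrow> h z) (at_right t0)"
    by (rule continuous_on_tendsto_compose[OF assms(2) lim z evS])
  then have "((\<lambda>t. cmod (h (cis t))) \<longlongrightarrow> cmod (h z)) (at_right t0)"
    by (rule tendsto_norm)
  then have "\<forall>\<^sub>F t in at_right t0. c < cmod (h (cis t))"
    using gt by (rule order_tendstoD)
  moreover have "\<forall>\<^sub>F t in at_right t0. t \<in> {t0<..<2*pi}"
    using t0(2) by (rule eventually_at_right_real)
  ultimately have "\<forall>\<^sub>F t in at_right t0. t < 2*pi \<and> cis t \<in> - S \<and> c < cmod (h (cis t))"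
    using evS by eventually_elim auto
  then obtain b where b: "b > t0" "\<And>t. t0 < t \<Longrightarrow> t < b \<Longrightarrow> t < 2*pi \<and> cis t \<in> - S \<and> c < cmod (h (cis t))"
    unfolding eventually_at_right_field by blast
  have "AE t in lborel. t \<notin> {t0<..<b}"
    using AE_circle_measureD[OF ae]
  proof (rule AE_mp, intro AE_I2 impI notI)
    fix t assume "t \<in> {0..<2*pi} \<longrightarrow> cis t \<notin> S \<longrightarrow> cmod (h (cis t)) \<le> c" "t \<in> {t0<..<b}"
    then show False
      using b(2)[of t] t0(1) by auto
  qed
  then have "emeasure lborel {t0<..<b} = 0"
    by (subst (asm) AE_iff_measurable[of "{t0<..<b}"]) auto
  then show False
    using b(1) by simp
qed

lemma Linf_norm_less_imp_AE:
  assumes "Linf_norm f < ereal \<epsilon>"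
  shows "AE z in circle_measure. cmod (f z) < \<epsilon>"
proof -
  have "AE z in circle_measure. ereal (cmod (f z)) \<le> Linf_norm f"
    unfolding Linf_norm_def by (rule esssup_AE)
  then show ?thesis
    by (rule AE_mp) (intro AE_I2 impI, use assms in \<open>metis le_less_trans less_ereal.simps(1)\<close>)
qed

lemma AE_imp_Linf_norm_le:
  assumes "f \<in> borel_measurable circle_measure" "AE z in circle_measure. cmod (f z) \<le> c"
  shows "Linf_norm f \<le> ereal c"
  unfolding Linf_norm_def using assms by (intro esssup_I) auto

text \<open>The arc length from \<open>cis t0\<close> to a point \<open>z\<close> of the circle,
  travelled in the direction \<open>k\<close>.\<close>

definition arc_param :: "real \<Rightarrow> int \<Rightarrow> complex \<Rightarrow> real" where
  "arc_param t0 k z = Arg2pi ((z / cis t0) powi k)"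

lemma log_at_eq: "log_at t0 k z = ln (arc_param t0 k z)"
  by (simp add: log_at_def arc_param_def)

lemma arc_param_cis:
  assumes "k \<in> {-1, 1}" "0 \<le> t" "t < 2*pi"
  shows "arc_param t0 k (cis (t0 + of_int k * t)) = t"
proof -
  have "(cis (t0 + of_int k * t) / cis t0) powi k = exp (\<i> * of_real t)"
    using assms(1)
    by (auto simp: cis_divide power_int_minus exp_minus simp flip: cis_conv_exp cis_inverse)
  then show ?thesis
    using assms(2,3) by (simp add: arc_param_def Arg2pi_exp)
qed

lemma cis_arc_param:
  assumes "k \<in> {-1, 1}" "cmod z = 1"
  shows "cis (t0 + of_int k * arc_param t0 k z) = z"
proof -
  let ?w = "(z / cis t0) powi k"
  have "cmod ?w = 1"
    using assms by (auto simp: norm_divide norm_power_int)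
  then have w: "cis (arc_param t0 k z) = ?w"
    by (simp add: arc_param_def cis_Arg2pi_unit)
  have "cis (t0 + of_int k * arc_param t0 k z) = cis t0 * cis (arc_param t0 k z) powi k"
    using assms(1) by (auto simp: cis_mult power_int_minus cis_inverse)
  also have "\<dots> = z"
    unfolding w using assms by (auto simp: power_int_minus)
  finally show ?thesis .
qed

lemma arc_param_bounds: "0 \<le> arc_param t0 k z" "arc_param t0 k z < 2*pi"
  using Arg2pi by (auto simp: arc_param_def)

lemma arc_param_pos:
  assumes "k \<in> {-1, 1}" "cmod z = 1" "z \<noteq> cis t0"
  shows "0 < arc_param t0 k z"
proof -
  have "arc_param t0 k z \<noteq> 0"
    using cis_arc_param[OF assms(1,2), of t0] assms(3) by auto
  then show ?thesis
    using arc_param_bounds(1)[of t0 k z] by linarith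
qed

text \<open>\<open>Arg2pi\<close> is discontinuous only on the nonnegative axis, which the rotated
  circle meets only in the image of \<open>cis t0\<close>.\<close>

lemma continuous_on_arc_param:
  assumes "k \<in> {-1, 1}"
  shows "continuous_on (sphere 0 1 - {cis t0}) (arc_param t0 k)"
proof -
  have isc: "isCont Arg2pi ((z / cis t0) powi k)" if "z \<in> sphere 0 1 - {cis t0}" for z
  proof (rule continuous_at_Arg2pi)
    have "0 < Arg2pi ((z / cis t0) powi k)"
      using arc_param_pos[OF assms, of z t0] that by (simp add: arc_param_def)
    then show "(z / cis t0) powi k \<notin> \<real>\<^sub>\<ge>\<^sub>0"
      using Arg2pi_eq_0[of "(z / cis t0) powi k"]
      by (auto simp: complex_nonneg_Reals_iff complex_is_Real_iff)
  qed
  have "continuous_on ((\<lambda>z. (z / cis t0) powi k) ` (sphere 0 1 - {cis t0})) Arg2pi"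
    by (intro continuous_at_imp_continuous_on) (use isc in blast)
  moreover have "continuous_on (sphere 0 1 - {cis t0}) (\<lambda>z. (z / cis t0) powi k)"
    by (intro continuous_intros) auto
  ultimately show ?thesis
    unfolding arc_param_def by (rule continuous_on_compose2) auto
qed

lemma continuous_on_log_at:
  assumes "k \<in> {-1, 1}"
  shows "continuous_on (sphere 0 1 - {cis t0}) (log_at t0 k)"
  unfolding log_at_eq[abs_def]
  using arc_param_pos[OF assms, of _ t0]
  by (intro continuous_on_ln continuous_on_arc_param assms) force

lemma side_arc_eq:
  assumes "k \<in> {-1, 1}" "s \<le> 2*pi"
  shows "side_arc t0 k s = {z \<in> sphere 0 1. 0 < arc_param t0 k z \<and> arc_param t0 k z < s}"
proof (intro subset_antisym subsetI)
  fix z assume "z \<in> side_arc t0 k s"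
  then show "z \<in> {z \<in> sphere 0 1. 0 < arc_param t0 k z \<and> arc_param t0 k z < s}"
    using arc_param_cis[OF assms(1)] assms(2) by (auto simp: side_arc_def)
next
  fix z assume "z \<in> {z \<in> sphere 0 1. 0 < arc_param t0 k z \<and> arc_param t0 k z < s}"
  then show "z \<in> side_arc t0 k s"
    unfolding side_arc_def using cis_arc_param[OF assms(1), of z t0] by (auto intro!: exI[of _ "arc_param t0 k z"])
qed

lemma side_arc_measurable:
  assumes "k \<in> {-1, 1}" "s \<le> 2*pi"
  shows "side_arc t0 k s \<in> sets circle_measure"
proof -
  have [measurable]: "arc_param t0 k \<in> borel_measurable circle_measure"
    by (rule measurable_circle_continuous_off_finite[OF _ continuous_on_arc_param[OF assms(1)]]) simp
  have "{z \<in> space circle_measure. 0 < arc_param t0 k z \<and> arc_param t0 k z < s} \<in> sets circle_measure"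
    by measurable
  then show ?thesis
    unfolding side_arc_eq[OF assms] space_circle_measure .
qed

section \<open>Local behaviour of the polynomials\<close>

text \<open>Both \<open>P\<close> and \<open>s\<close> may depend on \<open>\<epsilon>\<close>, so
  the notion covers functions with a mere one-sided limit and is stable under sums and
  products.\<close>

definition locally_trig :: "real \<Rightarrow> int \<Rightarrow> (complex \<Rightarrow> complex) \<Rightarrow> bool" where
  "locally_trig t0 k p \<longleftrightarrow> (\<forall>\<epsilon>>0. \<exists>P\<in>trig_polys. \<exists>s. 0 < s \<and> s < pi \<and>
     (\<forall>u. 0 < u \<and> u < s \<longrightarrow> cmod (p (cis (t0 + of_int k * u)) - P (ln u)) < \<epsilon>))"

lemma locally_trigE:
  assumes "locally_trig t0 k p" "\<epsilon> > 0"
  obtains P s where "P \<in> trig_polys" "0 < s" "s < pi"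
    "\<And>u. 0 < u \<Longrightarrow> u < s \<Longrightarrow> cmod (p (cis (t0 + of_int k * u)) - P (ln u)) < \<epsilon>"
  using assms unfolding locally_trig_def by blast

text \<open>In filter form two approximations combine without comparing their radii; the cap at 1
  restores the requirement \<open>s < pi\<close>.\<close>

lemma locally_trigI:
  assumes "\<And>\<epsilon>. \<epsilon> > 0 \<Longrightarrow> \<exists>P\<in>trig_polys. \<forall>\<^sub>F u in at_right 0. cmod (p (cis (t0 + of_int k * u)) - P (ln u)) < \<epsilon>"
  shows "locally_trig t0 k p"
  unfolding locally_trig_def
proof (intro allI impI)
  fix \<epsilon> :: real assume "\<epsilon> > 0"
  then obtain P where P: "P \<in> trig_polys" "\<forall>\<^sub>F u in at_right 0. cmod (p (cis (t0 + of_int k * u)) - P (ln u)) < \<epsilon>"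
    using assms by blast
  then obtain b where b: "b > 0" "\<And>u. 0 < u \<Longrightarrow> u < b \<Longrightarrow> cmod (p (cis (t0 + of_int k * u)) - P (ln u)) < \<epsilon>"
    unfolding eventually_at_right_field by blast
  have "0 < min b 1" "min b 1 < pi"
    using b(1) pi_gt3 by auto
  then show "\<exists>P\<in>trig_polys. \<exists>s. 0 < s \<and> s < pi \<and>
     (\<forall>u. 0 < u \<and> u < s \<longrightarrow> cmod (p (cis (t0 + of_int k * u)) - P (ln u)) < \<epsilon>)"
    using P(1) b(2) by (intro bexI[of _ P] exI[of _ "min b 1"]) auto
qed

lemma locally_trig_eventually:
  assumes "locally_trig t0 k p" "\<epsilon> > 0"
  obtains P where "P \<in> trig_polys"
    "\<forall>\<^sub>F u in at_right 0. cmod (p (cis (t0 + of_int k * u)) - P (ln u)) < \<epsilon>"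
proof -
  obtain P s where P: "P \<in> trig_polys" "0 < s"
    "\<And>u. 0 < u \<Longrightarrow> u < s \<Longrightarrow> cmod (p (cis (t0 + of_int k * u)) - P (ln u)) < \<epsilon>"
    using locally_trigE[OF assms] by metis
  have "\<forall>\<^sub>F u in at_right 0. u \<in> {0<..<s}"
    using P(2) by (rule eventually_at_right_real)
  then have "\<forall>\<^sub>F u in at_right 0. cmod (p (cis (t0 + of_int k * u)) - P (ln u)) < \<epsilon>"
    by (rule eventually_mono) (use P(3) in auto)
  with P(1) show ?thesis by (rule that)
qed

lemma locally_trig_limit:
  assumes "((\<lambda>u. p (cis (t0 + of_int k * u))) \<longlongrightarrow> c) (at_right 0)"
  shows "locally_trig t0 k p"
proof (rule locally_trigI)
  fix \<epsilon> :: real assume "\<epsilon> > 0"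
  with assms have "\<forall>\<^sub>F u in at_right 0. cmod (p (cis (t0 + of_int k * u)) - c) < \<epsilon>"
    unfolding tendsto_iff dist_norm by blast
  then show "\<exists>P\<in>trig_polys. \<forall>\<^sub>F u in at_right 0. cmod (p (cis (t0 + of_int k * u)) - P (ln u)) < \<epsilon>"
    by (intro bexI[of _ "\<lambda>_. c"] trig_polys_const)
qed

lemma locally_trig_add:
  assumes "locally_trig t0 k p" "locally_trig t0 k q"
  shows "locally_trig t0 k (\<lambda>z. p z + q z)"
proof (rule locally_trigI)
  fix \<epsilon> :: real assume "\<epsilon> > 0"
  then have e: "\<epsilon>/2 > 0" by simp
  obtain P where P: "P \<in> trig_polys"
    "\<forall>\<^sub>F u in at_right 0. cmod (p (cis (t0 + of_int k * u)) - P (ln u)) < \<epsilon>/2"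
    using locally_trig_eventually[OF assms(1) e] by metis
  obtain Q where Q: "Q \<in> trig_polys"
    "\<forall>\<^sub>F u in at_right 0. cmod (q (cis (t0 + of_int k * u)) - Q (ln u)) < \<epsilon>/2"
    using locally_trig_eventually[OF assms(2) e] by metis
  from P(2) Q(2) have "\<forall>\<^sub>F u in at_right 0. cmod (p (cis (t0 + of_int k * u)) + q (cis (t0 + of_int k * u)) - (P (ln u) + Q (ln u))) < \<epsilon>"
  proof eventually_elim
    case (elim u)
    then show ?case
      using norm_diff_triangle_ineq[of "p (cis (t0 + of_int k * u))" "q (cis (t0 + of_int k * u))" "P (ln u)" "Q (ln u)"]
      by linarith
  qed
  then show "\<exists>P\<in>trig_polys. \<forall>\<^sub>F u in at_right 0. cmod (p (cis (t0 + of_int k * u)) + q (cis (t0 + of_int k * u)) - P (ln u)) < \<epsilon>"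
    by (intro bexI[of _ "\<lambda>t. P t + Q t"] trig_polys.add P Q)
qed

lemma locally_trig_bounded:
  assumes "locally_trig t0 k p"
  obtains B where "B > 0" "\<forall>\<^sub>F u in at_right 0. cmod (p (cis (t0 + of_int k * u))) < B"
proof -
  obtain P where P: "P \<in> trig_polys"
    "\<forall>\<^sub>F u in at_right 0. cmod (p (cis (t0 + of_int k * u)) - P (ln u)) < 1"
    using locally_trig_eventually[OF assms zero_less_one] by metis
  obtain B where B: "B > 0" "\<And>t. cmod (P t) \<le> B"
    using trig_poly_bounded[OF P(1)] by metis
  from P(2) have "\<forall>\<^sub>F u in at_right 0. cmod (p (cis (t0 + of_int k * u))) < B + 1"
  proof eventually_elim
    case (elim u)
    then show ?case
      using norm_triangle_sub[of "p (cis (t0 + of_int k * u))" "P (ln u)"] B(2)[of "ln u"] by linarith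
  qed
  then show ?thesis
    using B(1) by (intro that[of "B + 1"]) auto
qed

lemma locally_trig_mult:
  assumes "locally_trig t0 k p" "locally_trig t0 k q"
  shows "locally_trig t0 k (\<lambda>z. p z * q z)"
proof (rule locally_trigI)
  fix \<epsilon> :: real assume "\<epsilon> > 0"
  obtain B where B: "B > 0" "\<forall>\<^sub>F u in at_right 0. cmod (q (cis (t0 + of_int k * u))) < B"
    using locally_trig_bounded[OF assms(2)] by metis
  have "\<epsilon> / (2 * B) > 0" using \<open>\<epsilon> > 0\<close> B by simp
  from locally_trig_eventually[OF assms(1) this]
  obtain P where P: "P \<in> trig_polys"
    "\<forall>\<^sub>F u in at_right 0. cmod (p (cis (t0 + of_int k * u)) - P (ln u)) < \<epsilon> / (2 * B)"
    by metis
  \<comment> \<open>The accuracy demanded from \<open>Q\<close> depends on the bound of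
    \<open>P\<close>, so \<open>P\<close> has to be chosen first.\<close>
  obtain C where C: "C > 0" "\<And>t. cmod (P t) \<le> C"
    using trig_poly_bounded[OF P(1)] by metis
  have "\<epsilon> / (2 * C) > 0" using \<open>\<epsilon> > 0\<close> C by simp
  from locally_trig_eventually[OF assms(2) this]
  obtain Q where Q: "Q \<in> trig_polys"
    "\<forall>\<^sub>F u in at_right 0. cmod (q (cis (t0 + of_int k * u)) - Q (ln u)) < \<epsilon> / (2 * C)"
    by metis
  from P(2) Q(2) B(2) have "\<forall>\<^sub>F u in at_right 0. cmod (p (cis (t0 + of_int k * u)) * q (cis (t0 + of_int k * u)) - P (ln u) * Q (ln u)) < \<epsilon>"
  proof eventually_elim
    case (elim u)
    let ?p = "p (cis (t0 + of_int k * u))" and ?q = "q (cis (t0 + of_int k * u))"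
    have "?p * ?q - P (ln u) * Q (ln u) = (?p - P (ln u)) * ?q + P (ln u) * (?q - Q (ln u))"
      by (simp add: algebra_simps)
    then have "cmod (?p * ?q - P (ln u) * Q (ln u)) \<le> cmod (?p - P (ln u)) * cmod ?q + cmod (P (ln u)) * cmod (?q - Q (ln u))"
      by (metis norm_mult norm_triangle_ineq)
    also have "cmod (?p - P (ln u)) * cmod ?q \<le> \<epsilon> / (2 * B) * B"
      using elim \<open>\<epsilon> > 0\<close> B(1) by (intro mult_mono) auto
    also have "cmod (P (ln u)) * cmod (?q - Q (ln u)) \<le> C * cmod (?q - Q (ln u))"
      using C by (intro mult_right_mono) auto
    also have "C * cmod (?q - Q (ln u)) < C * (\<epsilon> / (2 * C))"
      using elim C by (intro mult_strict_left_mono) auto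
    finally show ?case
      using B C by simp
  qed
  then show "\<exists>P\<in>trig_polys. \<forall>\<^sub>F u in at_right 0. cmod (p (cis (t0 + of_int k * u)) * q (cis (t0 + of_int k * u)) - P (ln u)) < \<epsilon>"
    by (intro bexI[of _ "\<lambda>t. P t * Q t"] trig_polys_mult P Q)
qed

lemma locally_trig_continuous:
  assumes "closed X" "continuous_on (sphere 0 1 - X) p" "cis t0 \<notin> X"
  shows "locally_trig t0 k p"
proof (rule locally_trig_limit)
  have lim: "((\<lambda>u. cis (t0 + of_int k * u)) \<longlongrightarrow> cis (t0 + of_int k * 0)) (at_right 0)"
    unfolding cis_conv_exp by (intro tendsto_intros)
  then have "\<forall>\<^sub>F u in at_right 0. cis (t0 + of_int k * u) \<in> - X"
    using assms by (intro topological_tendstoD) auto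
  then have ev: "\<forall>\<^sub>F u in at_right 0. cis (t0 + of_int k * u) \<in> sphere 0 1 - X"
    by (rule eventually_mono) simp
  show "((\<lambda>u. p (cis (t0 + of_int k * u))) \<longlongrightarrow> p (cis (t0 + of_int k * 0))) (at_right 0)"
    by (rule continuous_on_tendsto_compose[OF assms(2) lim _ ev]) (use assms in simp)
qed

text \<open>Base points are given by angles, which are determined only up to multiples of
  \<open>2 * pi\<close>; this identifies equivalent angles.\<close>

lemma locally_trig_cong:
  assumes "cis t0 = cis t1"
  shows "locally_trig t0 k p \<longleftrightarrow> locally_trig t1 k p"
  unfolding locally_trig_def using assms by (simp add: cis_mult[symmetric])

lemma filterlim_two_pi_minus: "filterlim (\<lambda>u. 2 * pi - u) (at_left (2 * pi)) (at_right 0)"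
  unfolding filterlim_at
proof (intro conjI)
  show "\<forall>\<^sub>F u in at_right 0. 2 * pi - u \<in> {..<2 * pi} \<and> 2 * pi - u \<noteq> 2 * pi"
    using eventually_at_right_less[of "0::real"] by (rule eventually_mono) auto
  have "((\<lambda>u. 2 * pi - u) \<longlongrightarrow> 2 * pi - 0) (at_right 0)"
    by (intro tendsto_intros)
  then show "((\<lambda>u. 2 * pi - u) \<longlongrightarrow> 2 * pi) (at_right 0)"
    by simp
qed

lemma cis_two_pi_minus: "cis (t + (2 * pi - u)) = cis (t - u)"
proof -
  have "cis (t + (2 * pi - u)) = cis (t - u) * cis (2 * pi)"
    by (simp add: cis_mult algebra_simps)
  then show ?thesis by simp
qed

text \<open>On the side \<open>m\<close> the function is exactly a monomial in \<open>ln u\<close>.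
  From the opposite side \<open>log_at\<close> equals \<open>ln (2 * pi - u)\<close>, so there is an
  ordinary limit.\<close>

lemma locally_trig_exp_log:
  assumes "k \<in> {-1, 1}" "m \<in> {-1, 1}"
  shows "locally_trig t0 k (\<lambda>z. exp (\<i> * of_real (l * log_at t0 m z)))"
proof (cases "k = m")
  case True
  have "\<forall>\<^sub>F u in at_right 0. u \<in> {0<..<2 * pi}"
    by (rule eventually_at_right_real) simp
  then have ev: "\<forall>\<^sub>F u in at_right 0. exp (\<i> * of_real (l * log_at t0 m (cis (t0 + of_int k * u)))) = 1 * cis (l * ln u)"
  proof (rule eventually_mono)
    fix u assume "u \<in> {0<..<2 * pi}"
    then have "log_at t0 m (cis (t0 + of_int k * u)) = ln u"
      using log_at_cis[OF assms(2), of u t0] True by simp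
    then show "exp (\<i> * of_real (l * log_at t0 m (cis (t0 + of_int k * u)))) = 1 * cis (l * ln u)"
      by (simp only: cis_conv_exp mult_1)
  qed
  show ?thesis
  proof (rule locally_trigI)
    fix \<epsilon> :: real assume "\<epsilon> > 0"
    with ev have "\<forall>\<^sub>F u in at_right 0. cmod (exp (\<i> * of_real (l * log_at t0 m (cis (t0 + of_int k * u)))) - 1 * cis (l * ln u)) < \<epsilon>"
      by (simp add: eventually_mono)
    then show "\<exists>P\<in>trig_polys. \<forall>\<^sub>F u in at_right 0. cmod (exp (\<i> * of_real (l * log_at t0 m (cis (t0 + of_int k * u)))) - P (ln u)) < \<epsilon>"
      by (intro bexI[of _ "\<lambda>t. 1 * cis (l * t)"] trig_polys.monomial)
  qed
next
  case False
  then have k: "k = - m" using assms by auto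
  have "\<forall>\<^sub>F u in at_right 0. u \<in> {0<..<2 * pi}"
    by (rule eventually_at_right_real) simp
  then have ev: "\<forall>\<^sub>F u in at_right 0. exp (\<i> * of_real (l * ln (2 * pi - u))) = exp (\<i> * of_real (l * log_at t0 m (cis (t0 + of_int k * u))))"
  proof (rule eventually_mono)
    fix u assume u: "u \<in> {0<..<2 * pi}"
    have "cis (t0 + of_int k * u) = cis (t0 + of_int m * (2 * pi - u))"
      using assms(2) cis_two_pi_minus[of t0 u] cis_two_pi_minus[of "t0 - (2 * pi - u)" "0"]
      by (auto simp: k algebra_simps)
    then show "exp (\<i> * of_real (l * ln (2 * pi - u))) = exp (\<i> * of_real (l * log_at t0 m (cis (t0 + of_int k * u))))"
      using log_at_cis[OF assms(2), of "2 * pi - u" t0] u by simp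
  qed
  have "((\<lambda>u. exp (\<i> * of_real (l * ln (2 * pi - u)))) \<longlongrightarrow> exp (\<i> * of_real (l * ln (2 * pi - 0)))) (at_right 0)"
    by (intro tendsto_intros) auto
  then have "((\<lambda>u. exp (\<i> * of_real (l * log_at t0 m (cis (t0 + of_int k * u))))) \<longlongrightarrow> exp (\<i> * of_real (l * ln (2 * pi - 0)))) (at_right 0)"
    by (rule Lim_transform_eventually[OF _ ev])
  then show ?thesis
    by (rule locally_trig_limit)
qed

section \<open>The generators and their one-sided behaviour\<close>

locale arc_generator =
  fixes g :: "complex \<Rightarrow> real"
  assumes continuous_g: "continuous_on (sphere 0 1 - {1}) g"
    and g_at_0: "((\<lambda>t. g (cis t)) \<longlongrightarrow> 1) (at_right 0)"
    and g_at_2pi: "((\<lambda>t. g (cis t)) \<longlongrightarrow> 0) (at_left (2*pi))"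
    and strict_antimono_g: "strict_antimono_on {0<..<2*pi} (\<lambda>t. g (cis t))"
begin

lemma continuous_on_g_at: "continuous_on (sphere 0 1 - {cis t0}) (g_at g t0)"
proof -
  have "continuous_on (sphere 0 1 - {cis t0}) (\<lambda>z. z / cis t0)"
    by (intro continuous_intros) auto
  moreover have "(\<lambda>z. z / cis t0) ` (sphere 0 1 - {cis t0}) \<subseteq> sphere 0 1 - {1}"
    by (auto simp: norm_divide)
  ultimately show ?thesis
    unfolding g_at_def[abs_def] by (rule continuous_on_compose2[OF continuous_g])
qed

lemma locally_trig_g_at:
  assumes "k \<in> {-1, 1}"
  shows "locally_trig t0 k (\<lambda>z. of_real (g_at g t0 z))"
proof -
  have eq: "g_at g t0 (cis (t0 + of_int k * u)) = g (cis (of_int k * u))" for u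
    by (rule g_at_cis)
  have "\<exists>c. ((\<lambda>u. g (cis (of_int k * u))) \<longlongrightarrow> c) (at_right 0)"
  proof (cases "k = 1")
    case True
    then show ?thesis using g_at_0 by auto
  next
    case False
    then have "k = -1" using assms by simp
    moreover have "((\<lambda>u. g (cis (2 * pi - u))) \<longlongrightarrow> 0) (at_right 0)"
      by (rule filterlim_compose[OF g_at_2pi filterlim_two_pi_minus])
    ultimately show ?thesis
      using cis_two_pi_minus[of 0] by auto
  qed
  then obtain c where "((\<lambda>u. g (cis (of_int k * u))) \<longlongrightarrow> c) (at_right 0)" ..
  then have "((\<lambda>u. complex_of_real (g_at g t0 (cis (t0 + of_int k * u)))) \<longlongrightarrow> of_real c) (at_right 0)"
    unfolding eq by (rule tendsto_of_real)
  then show ?thesis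
    by (rule locally_trig_limit)
qed

lemma locally_trig_AP_polynomial:
  assumes "p \<in> AP_polynomials g S" "k \<in> {-1, 1}"
  shows "locally_trig t0 k p"
  using assms(1)
proof induction
  case (const c)
  show ?case by (rule locally_trig_limit[of _ _ _ c]) simp
next
  case (g_var t1)
  show ?case
  proof (cases "cis t0 = cis t1")
    case True
    then show ?thesis
      using locally_trig_g_at[OF assms(2), of t1] locally_trig_cong by blast
  next
    case False
    have "continuous_on (sphere 0 1 - {cis t1}) (\<lambda>z. complex_of_real (g_at g t1 z))"
      by (intro continuous_on_of_real continuous_on_g_at)
    then show ?thesis
      using False by (intro locally_trig_continuous[of "{cis t1}"]) auto
  qed
next
  case (exp_var t1 m l)
  show ?case
  proof (cases "cis t0 = cis t1")
    case True
    then show ?thesis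
      using locally_trig_exp_log[OF assms(2) exp_var(2), of t1 l] locally_trig_cong by blast
  next
    case False
    have "continuous_on (sphere 0 1 - {cis t1}) (\<lambda>z. exp (\<i> * of_real (l * log_at t1 m z)))"
      by (intro continuous_intros continuous_on_log_at exp_var)
    then show ?thesis
      using False by (intro locally_trig_continuous[of "{cis t1}"]) auto
  qed
qed (auto intro: locally_trig_add locally_trig_mult)

text \<open>Finiteness of \<open>X\<close> gives measurability, and \<open>X \<subseteq> S\<close>
  gives continuity off \<open>S\<close>.\<close>

lemma AP_polynomial_continuous:
  assumes "p \<in> AP_polynomials g S"
  obtains X where "finite X" "X \<subseteq> S" "continuous_on (sphere 0 1 - X) p"
proof -
  from assms have "\<exists>X. finite X \<and> X \<subseteq> S \<and> continuous_on (sphere 0 1 - X) p"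
  proof induction
    case (const c)
    show ?case by (intro exI[of _ "{}"]) auto
  next
    case (g_var t1)
    then show ?case
      by (intro exI[of _ "{cis t1}"] conjI continuous_on_of_real continuous_on_g_at) auto
  next
    case (exp_var t1 m l)
    have "continuous_on (sphere 0 1 - {cis t1}) (\<lambda>z. exp (\<i> * of_real (l * log_at t1 m z)))"
      by (intro continuous_intros continuous_on_log_at exp_var)
    then show ?case
      using exp_var by (intro exI[of _ "{cis t1}"]) auto
  next
    case (add p q)
    then obtain X Y where "finite X" "X \<subseteq> S" "continuous_on (sphere 0 1 - X) p"
      "finite Y" "Y \<subseteq> S" "continuous_on (sphere 0 1 - Y) q" by blast
    then show ?case
      by (intro exI[of _ "X \<union> Y"] conjI continuous_on_add) (auto elim: continuous_on_subset)
  next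
    case (mult p q)
    then obtain X Y where "finite X" "X \<subseteq> S" "continuous_on (sphere 0 1 - X) p"
      "finite Y" "Y \<subseteq> S" "continuous_on (sphere 0 1 - Y) q" by blast
    then show ?case
      by (intro exI[of _ "X \<union> Y"] conjI continuous_on_mult) (auto elim: continuous_on_subset)
  qed
  then show ?thesis using that by blast
qed


section \<open>The uniform closure of the polynomials lies in \<open>AP S\<close>\<close>

lemma measurable_AP_polynomial: "p \<in> AP_polynomials g S \<Longrightarrow> p \<in> borel_measurable circle_measure"
  by (erule AP_polynomial_continuous) (rule measurable_circle_continuous_off_finite)

text \<open>The substitution \<open>u = s * exp t\<close> used for arcs becomes the translation
  \<open>t + ln s\<close> in the logarithmic coordinate.\<close>

lemma almost_periodic_on_arc_log:
  assumes "P \<in> trig_polys" "k \<in> {-1, 1}" "0 < s" "s \<le> 2*pi"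
  shows "almost_periodic_on_arc t0 k s (\<lambda>z. P (log_at t0 k z))"
  unfolding almost_periodic_on_arc_def
proof (intro conjI exI)
  have "side_arc t0 k s \<subseteq> sphere 0 1 - {cis t0}"
  proof
    fix z assume "z \<in> side_arc t0 k s"
    then have "z \<in> sphere 0 1" "0 < arc_param t0 k z"
      using side_arc_eq[OF assms(2,4)] by auto
    moreover have "arc_param t0 k (cis t0) = 0"
      using arc_param_cis[OF assms(2), of 0 t0] by simp
    ultimately show "z \<in> sphere 0 1 - {cis t0}" by auto
  qed
  then have "continuous_on (side_arc t0 k s) (log_at t0 k)"
    by (rule continuous_on_subset[OF continuous_on_log_at[OF assms(2)]])
  then show "continuous_on (side_arc t0 k s) (\<lambda>z. P (log_at t0 k z))"
    by (rule continuous_on_compose2[OF continuous_on_trig_poly[OF assms(1), of UNIV]]) simp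
  show "almost_periodic (\<lambda>t. P (1 * t + ln s))"
    by (intro trig_poly_almost_periodic trig_polys_affine assms)
  show "\<forall>t<0. P (log_at t0 k (cis (t0 + of_int k * s * exp t))) = P (1 * t + ln s)"
  proof (intro allI impI)
    fix t :: real assume "t < 0"
    then have "s * exp t < s * 1"
      using assms(3) by (intro mult_strict_left_mono) auto
    then have "s * exp t < 2*pi"
      using assms(4) by simp
    then have "log_at t0 k (cis (t0 + of_int k * (s * exp t))) = ln (s * exp t)"
      using assms by (intro log_at_cis) auto
    also have "\<dots> = 1 * t + ln s"
      using assms(3) by (simp add: ln_mult)
    finally show "P (log_at t0 k (cis (t0 + of_int k * s * exp t))) = P (1 * t + ln s)"
      by (simp add: mult.assoc)
  qed
qed

text \<open>Near \<open>cis t0\<close> a close polynomial is itself close to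
  \<open>P (log_at t0 k z)\<close>. Two errors of \<open>\<epsilon>/4\<close> leave room for the
  strict inequality on the essential supremum.\<close>

lemma Linf_closure_subset_AP_circle:
  "Linf_closure (AP_polynomials g S) \<subseteq> AP_circle"
proof
  fix f assume f: "f \<in> Linf_closure (AP_polynomials g S)"
  then have f_meas [measurable]: "f \<in> borel_measurable circle_measure"
    by (simp add: Linf_closure_def Linf_def)
  have "\<exists>s. 0 < s \<and> s < pi \<and> (\<exists>fk. \<forall>k\<in>{-1, 1}. almost_periodic_on_arc t0 k s (fk k) \<and>
      esssup (restrict_space circle_measure (side_arc t0 k s)) (\<lambda>z. ereal (cmod (f z - fk k z))) < ereal \<epsilon>)"
    if "\<epsilon> > 0" for t0 \<epsilon>
  proof -
    have e: "\<epsilon>/4 > 0" using that by simp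
    then obtain p where p: "p \<in> AP_polynomials g S" "Linf_norm (\<lambda>z. f z - p z) < ereal (\<epsilon>/4)"
      using f unfolding Linf_closure_def by blast
    have "\<forall>k\<in>{-1, 1::int}. \<exists>P s. P \<in> trig_polys \<and> 0 < s \<and> s < pi \<and>
        (\<forall>u. 0 < u \<and> u < s \<longrightarrow> cmod (p (cis (t0 + of_int k * u)) - P (ln u)) < \<epsilon>/4)"
      using locally_trig_AP_polynomial[OF p(1), of _ t0] e unfolding locally_trig_def by blast
    then obtain P s where Ps: "\<And>k. k \<in> {-1, 1::int} \<Longrightarrow> P k \<in> trig_polys \<and> 0 < s k \<and> s k < pi \<and>
        (\<forall>u. 0 < u \<and> u < s k \<longrightarrow> cmod (p (cis (t0 + of_int k * u)) - P k (ln u)) < \<epsilon>/4)"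
      by metis
    \<comment> \<open>\<open>AP_circle\<close> asks for one arc length serving both sides.\<close>
    define r where "r = min (s (-1)) (s 1)"
    have r: "0 < r" "r < pi" "\<And>k. k \<in> {-1, 1} \<Longrightarrow> r \<le> s k"
      using Ps[of "-1"] Ps[of 1] by (auto simp: r_def)
    have r2: "r \<le> 2*pi" using r(2) pi_gt_zero by linarith
    show ?thesis
    proof (intro exI[of _ r] exI[of _ "\<lambda>k z. P k (log_at t0 k z)"] conjI r(1,2) ballI)
      fix k :: int assume k: "k \<in> {-1, 1}"
      show "almost_periodic_on_arc t0 k r (\<lambda>z. P k (log_at t0 k z))"
        using Ps[OF k] r r2 k by (intro almost_periodic_on_arc_log) auto
      have "continuous_on (sphere 0 1 - {cis t0}) (\<lambda>z. P k (log_at t0 k z))"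
        by (rule continuous_on_compose2[OF continuous_on_trig_poly[of "P k" UNIV] continuous_on_log_at[OF k]])
          (use Ps[OF k] in auto)
      then have [measurable]: "(\<lambda>z. P k (log_at t0 k z)) \<in> borel_measurable circle_measure"
        by (rule measurable_circle_continuous_off_finite[rotated]) simp
      have "AE z in circle_measure. z \<in> side_arc t0 k r \<longrightarrow> cmod (f z - P k (log_at t0 k z)) \<le> \<epsilon>/2"
        using Linf_norm_less_imp_AE[OF p(2)]
      proof (rule eventually_mono, intro impI)
        fix z assume fp: "cmod (f z - p z) < \<epsilon>/4" and "z \<in> side_arc t0 k r"
        then obtain u where u: "z = cis (t0 + of_int k * u)" "0 < u" "u < r"
          by (auto simp: side_arc_def)
        then have "cmod (p z - P k (ln u)) < \<epsilon>/4"
          using Ps[OF k] r(3)[OF k] by auto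
        moreover have "log_at t0 k z = ln u"
          unfolding u(1) using u r2 by (intro log_at_cis k) auto
        ultimately show "cmod (f z - P k (log_at t0 k z)) \<le> \<epsilon>/2"
          using fp norm_triangle_ineq[of "f z - p z" "p z - P k (ln u)"] by simp
      qed
      then have "AE z in restrict_space circle_measure (side_arc t0 k r).
          ereal (cmod (f z - P k (log_at t0 k z))) \<le> ereal (\<epsilon>/2)"
        using side_arc_measurable[OF k r2] by (subst AE_restrict_space_iff) auto
      moreover have "(\<lambda>z. ereal (cmod (f z - P k (log_at t0 k z)))) \<in> borel_measurable (restrict_space circle_measure (side_arc t0 k r))"
        by (rule measurable_restrict_space1) measurable
      ultimately have "esssup (restrict_space circle_measure (side_arc t0 k r))
          (\<lambda>z. ereal (cmod (f z - P k (log_at t0 k z)))) \<le> ereal (\<epsilon>/2)"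
        by (rule esssup_I[rotated])
      also have "\<dots> < ereal \<epsilon>" using that by simp
      finally show "esssup (restrict_space circle_measure (side_arc t0 k r))
          (\<lambda>z. ereal (cmod (f z - P k (log_at t0 k z)))) < ereal \<epsilon>" .
    qed
  qed
  then show "f \<in> AP_circle"
    using f by (simp add: AP_circle_def Linf_closure_def)
qed

text \<open>Off \<open>S\<close> the approximating polynomials are continuous and uniformly Cauchy,
  so their pointwise limit is the continuous representative.\<close>

lemma Linf_closure_continuous_representative:
  assumes "closed S" "f \<in> Linf_closure (AP_polynomials g S)"
  shows "\<exists>h. continuous_on (sphere 0 1 - S) h \<and> (AE z in circle_measure. z \<notin> S \<longrightarrow> f z = h z)"
proof -
  have "\<exists>p\<in>AP_polynomials g S. Linf_norm (\<lambda>z. f z - p z) < ereal (1 / Suc n)" for n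
    using assms(2) by (simp add: Linf_closure_def)
  then obtain p where p: "\<And>n. p n \<in> AP_polynomials g S"
    "\<And>n. Linf_norm (\<lambda>z. f z - p n z) < ereal (1 / Suc n)"
    by metis
  let ?U = "sphere 0 1 - S"
  have cont: "continuous_on ?U (p n)" for n
  proof -
    obtain X where "X \<subseteq> S" "continuous_on (sphere 0 1 - X) (p n)"
      using AP_polynomial_continuous[OF p(1)] by metis
    then show ?thesis
      by (auto elim: continuous_on_subset)
  qed
  have ae: "AE z in circle_measure. cmod (f z - p n z) < 1 / Suc n" for n
    by (rule Linf_norm_less_imp_AE[OF p(2)])
  \<comment> \<open>Continuity upgrades the almost-everywhere estimate to every point off
    \<open>S\<close>.\<close>
  have close: "cmod (p n z - p m z) \<le> 1 / Suc n + 1 / Suc m" if "z \<in> ?U" for n m z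
  proof (rule AE_circle_continuous_norm_le[OF assms(1) _ _ that])
    show "continuous_on ?U (\<lambda>z. p n z - p m z)"
      by (intro continuous_on_diff cont)
    show "AE z in circle_measure. z \<notin> S \<longrightarrow> cmod (p n z - p m z) \<le> 1 / Suc n + 1 / Suc m"
      using ae[of n] ae[of m]
    proof eventually_elim
      case (elim z)
      then show ?case
        using norm_triangle_ineq4[of "f z - p m z" "f z - p n z"] by simp
    qed
  qed
  have conv: "convergent (\<lambda>n. p n z)" if z: "z \<in> ?U" for z
  proof (rule Cauchy_convergent, rule metric_CauchyI)
    fix e :: real assume "e > 0"
    then obtain N where N: "1 / Suc N < e / 2"
      using reals_Archimedean[of "e/2"] by (auto simp: inverse_eq_divide)
    have "dist (p m z) (p n z) < e" if "m \<ge> N" "n \<ge> N" for m n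
    proof -
      have "1 / Suc m \<le> 1 / Suc N" "1 / Suc n \<le> 1 / Suc N"
        using that by (auto intro!: divide_left_mono)
      then show ?thesis
        using close[OF z, of m n] N by (simp add: dist_norm)
    qed
    then show "\<exists>N. \<forall>m\<ge>N. \<forall>n\<ge>N. dist (p m z) (p n z) < e" by blast
  qed
  define h where "h z = lim (\<lambda>n. p n z)" for z
  have lim: "(\<lambda>n. p n z) \<longlonglongrightarrow> h z" if "z \<in> ?U" for z
    using conv[OF that] by (simp add: h_def convergent_LIMSEQ_iff)
  have inv: "(\<lambda>m. 1 / real (Suc m)) \<longlonglongrightarrow> 0"
    using LIMSEQ_inverse_real_of_nat by (simp add: inverse_eq_divide)
  have close': "cmod (p n z - h z) \<le> 1 / Suc n" if z: "z \<in> ?U" for n z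
  proof -
    have "(\<lambda>m. cmod (p n z - p m z)) \<longlonglongrightarrow> cmod (p n z - h z)"
      by (intro tendsto_intros lim z)
    moreover have "(\<lambda>m. 1 / Suc n + 1 / Suc m) \<longlonglongrightarrow> 1 / Suc n + 0"
      by (intro tendsto_intros inv)
    ultimately have "cmod (p n z - h z) \<le> 1 / Suc n + 0"
      by (rule LIMSEQ_le) (use close[OF z] in blast)
    then show ?thesis by simp
  qed
  have "uniform_limit ?U p h sequentially"
  proof (rule uniform_limitI)
    fix e :: real assume "e > 0"
    with inv have "\<forall>\<^sub>F n in sequentially. 1 / real (Suc n) < e"
      by (rule order_tendstoD)
    then show "\<forall>\<^sub>F n in sequentially. \<forall>z\<in>?U. dist (p n z) (h z) < e"
      by (rule eventually_mono) (auto simp: dist_norm intro!: le_less_trans[OF close'])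
  qed
  then have "continuous_on ?U h"
    by (rule uniform_limit_theorem[rotated]) (simp_all add: cont)
  moreover have "AE z in circle_measure. \<forall>n. cmod (f z - p n z) < 1 / Suc n"
    using ae by (simp add: AE_all_countable)
  then have "AE z in circle_measure. z \<notin> S \<longrightarrow> f z = h z"
    using AE_circle_in_sphere
  proof eventually_elim
    case (elim z)
    show ?case
    proof
      assume "z \<notin> S"
      then have z: "z \<in> ?U" using elim by simp
      have "(\<lambda>n. p n z) \<longlonglongrightarrow> f z"
      proof (rule LIM_zero_cancel, rule Lim_null_comparison[OF _ inv])
        show "\<forall>\<^sub>F n in sequentially. cmod (p n z - f z) \<le> 1 / real (Suc n)"
          using elim(1) by (auto simp: norm_minus_commute intro!: always_eventually less_imp_le)
      qed
      then show "f z = h z"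
        using lim[OF z] by (rule LIMSEQ_unique)
    qed
  qed
  ultimately show ?thesis by blast
qed

lemma Linf_closure_subset_AP:
  assumes "closed S"
  shows "Linf_closure (AP_polynomials g S) \<subseteq> AP S"
  using Linf_closure_subset_AP_circle[of S] Linf_closure_continuous_representative[OF assms]
  unfolding AP_def by blast

end

subsection \<open>Uniform limits of the polynomials\<close>

context arc_generator
begin

text \<open>A finite set is exempted because the variables carry meaningless values at their base
  points; being null, it does not affect \<open>Linf_norm\<close>.\<close>

definition poly_limit :: "complex set \<Rightarrow> (complex \<Rightarrow> complex) \<Rightarrow> bool" where
  "poly_limit S p \<longleftrightarrow> (\<forall>\<epsilon>>0. \<exists>q\<in>AP_polynomials g S. \<exists>X. finite X \<and>
     (\<forall>z\<in>sphere 0 1 - X. cmod (p z - q z) < \<epsilon>))"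

lemma poly_limitD:
  assumes "poly_limit S p" "\<epsilon> > 0"
  obtains q X where "q \<in> AP_polynomials g S" "finite X" "\<And>z. z \<in> sphere 0 1 - X \<Longrightarrow> cmod (p z - q z) < \<epsilon>"
  using assms unfolding poly_limit_def by blast

lemma poly_limit_add:
  assumes "poly_limit S p" "poly_limit S q"
  shows "poly_limit S (\<lambda>z. p z + q z)"
  unfolding poly_limit_def
proof (intro allI impI)
  fix \<epsilon> :: real assume "\<epsilon> > 0"
  then have e: "\<epsilon>/2 > 0" by simp
  obtain p' X where p': "p' \<in> AP_polynomials g S" "finite X" "\<And>z. z \<in> sphere 0 1 - X \<Longrightarrow> cmod (p z - p' z) < \<epsilon>/2"
    by (rule poly_limitD[OF assms(1) e]) (rule that)
  obtain q' Y where q': "q' \<in> AP_polynomials g S" "finite Y" "\<And>z. z \<in> sphere 0 1 - Y \<Longrightarrow> cmod (q z - q' z) < \<epsilon>/2"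
    by (rule poly_limitD[OF assms(2) e]) (rule that)
  have "cmod (p z + q z - (p' z + q' z)) < \<epsilon>" if "z \<in> sphere 0 1 - (X \<union> Y)" for z
    using norm_diff_triangle_ineq[of "p z" "q z" "p' z" "q' z"] p'(3)[of z] q'(3)[of z] that by simp
  then show "\<exists>r\<in>AP_polynomials g S. \<exists>X. finite X \<and> (\<forall>z\<in>sphere 0 1 - X. cmod (p z + q z - r z) < \<epsilon>)"
    using p'(1,2) q'(1,2)
    by (intro bexI[of _ "\<lambda>z. p' z + q' z"] exI[of _ "X \<union> Y"]) (auto intro: AP_polynomials.add)
qed

lemma poly_limit_mult_polynomial:
  assumes "poly_limit S p" "q \<in> AP_polynomials g S" "\<And>z. cmod (q z) \<le> B"
  shows "poly_limit S (\<lambda>z. p z * q z)"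
  unfolding poly_limit_def
proof (intro allI impI)
  fix \<epsilon> :: real assume "\<epsilon> > 0"
  have B: "B \<ge> 0" using assms(3)[of 0] norm_ge_zero[of "q 0"] by linarith
  then have e: "\<epsilon>/(B + 1) > 0" using \<open>\<epsilon> > 0\<close> by simp
  obtain p' X where p': "p' \<in> AP_polynomials g S" "finite X" "\<And>z. z \<in> sphere 0 1 - X \<Longrightarrow> cmod (p z - p' z) < \<epsilon>/(B + 1)"
    by (rule poly_limitD[OF assms(1) e]) (rule that)
  have "cmod (p z * q z - p' z * q z) < \<epsilon>" if "z \<in> sphere 0 1 - X" for z
  proof -
    have "cmod (p z * q z - p' z * q z) = cmod (p z - p' z) * cmod (q z)"
      by (simp add: left_diff_distrib flip: norm_mult)
    also have "\<dots> \<le> cmod (p z - p' z) * (B + 1)"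
      using assms(3)[of z] by (intro mult_left_mono) auto
    also have "\<dots> < \<epsilon>/(B + 1) * (B + 1)"
      using p'(3)[OF that] B by (intro mult_strict_right_mono) auto
    finally show ?thesis using B by simp
  qed
  then show "\<exists>r\<in>AP_polynomials g S. \<exists>X. finite X \<and> (\<forall>z\<in>sphere 0 1 - X. cmod (p z * q z - r z) < \<epsilon>)"
    using p'(1,2) assms(2)
    by (intro bexI[of _ "\<lambda>z. p' z * q z"] exI[of _ "X"]) (auto intro: AP_polynomials.mult)
qed

lemma poly_limit_const: "poly_limit S (\<lambda>_. c)"
  unfolding poly_limit_def by (intro allI impI bexI[of _ "\<lambda>_. c"] exI[of _ "{}"]) (auto intro: AP_polynomials.const)

lemma poly_limit_sum:
  "finite I \<Longrightarrow> (\<And>i. i \<in> I \<Longrightarrow> poly_limit S (p i)) \<Longrightarrow> poly_limit S (\<lambda>z. \<Sum>i\<in>I. p i z)"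
  by (induction I rule: finite_induct) (simp_all add: poly_limit_const poly_limit_add)

text \<open>Stone--Weierstrass applies because \<open>t \<mapsto> g (cis t)\<close>, extended by its one-sided limits, separates
  the points of the closed interval, its two end points included.\<close>

lemma poly_limit_real_interval:
  fixes \<psi> :: "real \<Rightarrow> real"
  assumes "cis t0 \<in> S" "continuous_on {0..2*pi} \<psi>" "\<epsilon> > 0"
  shows "\<exists>q\<in>AP_polynomials g S. \<forall>t. 0 < t \<and> t < 2*pi \<longrightarrow> cmod (of_real (\<psi> t) - q (cis (t0 + t))) < \<epsilon>"
proof -
  define G where "G t = (if t = 0 then 1 else if t = 2*pi then 0 else g (cis t))" for t
  \<comment> \<open>The limits at the ends give only weak bounds. Strict monotonicity between
    \<open>t\<close> and the auxiliary points \<open>u\<close>, \<open>v\<close> makes them strict,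
    so that no interior value equals an end value.\<close>
  have g_bounds: "0 < g (cis t)" "g (cis t) < 1" if t: "t \<in> {0<..<2*pi}" for t
  proof -
    have mono: "g (cis v) < g (cis u)" if "u \<in> {0<..<2*pi}" "v \<in> {0<..<2*pi}" "u < v" for u v
      using strict_antimono_g that unfolding monotone_on_def by blast
    define u where "u = t / 2"
    define v where "v = (t + 2*pi) / 2"
    have u: "u \<in> {0<..<2*pi}" "u < t" and v: "v \<in> {0<..<2*pi}" "t < v"
      using t by (auto simp: u_def v_def)
    have "\<forall>\<^sub>F w in at_right 0. w \<in> {0<..<u}"
      using u by (intro eventually_at_right_real) auto
    then have "\<forall>\<^sub>F w in at_right 0. g (cis u) \<le> g (cis w)"
      by (rule eventually_mono) (use mono[of _ u] u in \<open>auto intro!: less_imp_le\<close>)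
    then have "g (cis u) \<le> 1"
      by (rule tendsto_lowerbound[OF g_at_0]) simp
    then show "g (cis t) < 1"
      using mono[OF u(1) t u(2)] by simp
    have "\<forall>\<^sub>F w in at_left (2*pi). w \<in> {v<..<2*pi}"
      using v by (intro eventually_at_left_real) auto
    then have "\<forall>\<^sub>F w in at_left (2*pi). g (cis w) \<le> g (cis v)"
      by (rule eventually_mono) (use mono[of v] v in \<open>auto intro!: less_imp_le\<close>)
    then have "0 \<le> g (cis v)"
      by (rule tendsto_upperbound[OF g_at_2pi]) simp
    then show "0 < g (cis t)"
      using mono[OF t v(1) v(2)] by simp
  qed
  have G_inj: "G u \<noteq> G v" if "u \<in> {0..2*pi}" "v \<in> {0..2*pi}" "u < v" for u v
  proof (cases "u = 0 \<or> v = 2*pi")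
    case True
    then show ?thesis
      using that g_bounds[of u] g_bounds[of v] by (auto simp: G_def)
  next
    case False
    then have "g (cis v) < g (cis u)"
      using strict_antimono_g that unfolding monotone_on_def by auto
    then show ?thesis using False that by (auto simp: G_def)
  qed
  have cis_neq_1: "cis t \<noteq> 1" if "0 < t" "t < 2*pi" for t
  proof
    assume "cis t = 1"
    moreover have "Arg2pi (cis t) = t"
      using that by (simp add: cis_conv_exp Arg2pi_exp)
    ultimately show False using that Arg2pi_of_real[of 1] by simp
  qed
  have G_cont: "continuous_on {0..2*pi} G"
    unfolding continuous_on_def
  proof
    fix t assume t: "t \<in> {0..2*pi}"
    consider "t = 0" | "t = 2*pi" | "0 < t" "t < 2*pi" using t by force
    then show "(G \<longlongrightarrow> G t) (at t within {0..2*pi})"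
    proof cases
      case 1
      have "\<forall>\<^sub>F w in at_right 0. w \<in> {0<..<2*pi}"
        by (rule eventually_at_right_real) simp
      then have ev: "\<forall>\<^sub>F w in at_right 0. g (cis w) = G w"
        by (rule eventually_mono) (auto simp: G_def)
      have "(G \<longlongrightarrow> 1) (at_right 0)"
        by (rule Lim_transform_eventually[OF g_at_0 ev])
      then show ?thesis
        using 1 by (simp add: G_def at_within_Icc_at_right)
    next
      case 2
      have "\<forall>\<^sub>F w in at_left (2*pi). w \<in> {0<..<2*pi}"
        by (rule eventually_at_left_real) simp
      then have ev: "\<forall>\<^sub>F w in at_left (2*pi). g (cis w) = G w"
        by (rule eventually_mono) (auto simp: G_def)
      have "(G \<longlongrightarrow> 0) (at_left (2*pi))"
        by (rule Lim_transform_eventually[OF g_at_2pi ev])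
      then show ?thesis
        using 2 by (simp add: G_def at_within_Icc_at_left)
    next
      case 3
      have "continuous_on {0<..<2*pi} (\<lambda>t. g (cis t))"
        by (rule continuous_on_compose2[OF continuous_g]) (use cis_neq_1 in \<open>auto intro!: continuous_on_cis continuous_intros\<close>)
      then have "isCont (\<lambda>t. g (cis t)) t"
        using 3 by (simp add: continuous_on_eq_continuous_at)
      then have lim: "((\<lambda>t. g (cis t)) \<longlongrightarrow> g (cis t)) (at t)"
        by (simp add: isCont_def)
      have "\<forall>\<^sub>F w in at t. w \<in> {0<..<2*pi}"
        using 3 by (intro eventually_at_in_open') auto
      then have ev: "\<forall>\<^sub>F w in at t. g (cis w) = G w"
        by (rule eventually_mono) (auto simp: G_def)
      have "(G \<longlongrightarrow> g (cis t)) (at t)"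
        by (rule Lim_transform_eventually[OF lim ev])
      then have "(G \<longlongrightarrow> G t) (at t)"
        using 3 by (simp add: G_def)
      then show ?thesis
        by (rule tendsto_within_subset) simp
    qed
  qed
  \<comment> \<open>Agreement with a polynomial is required only on the open interval: both ends
    correspond to the single point \<open>cis t0\<close>, where \<open>\<phi>\<close> may take two
    different values.\<close>
  define R where "R = {\<phi>. continuous_on {0..2*pi} \<phi> \<and>
    (\<exists>q\<in>AP_polynomials g S. \<forall>t. 0 < t \<and> t < 2*pi \<longrightarrow> q (cis (t0 + t)) = complex_of_real (\<phi> t))}"
  interpret function_ring_on R "{0..2*pi}"
  proof
    show "compact {0..2*pi}" by simp
  next
    fix f assume "f \<in> R"
    then show "continuous_on {0..2*pi} f" by (simp add: R_def)
  next
    fix f h assume "f \<in> R" "h \<in> R"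
    then obtain q r where "continuous_on {0..2*pi} f" "continuous_on {0..2*pi} h"
      and q: "q \<in> AP_polynomials g S" "\<forall>t. 0 < t \<and> t < 2*pi \<longrightarrow> q (cis (t0 + t)) = complex_of_real (f t)"
      and r: "r \<in> AP_polynomials g S" "\<forall>t. 0 < t \<and> t < 2*pi \<longrightarrow> r (cis (t0 + t)) = complex_of_real (h t)"
      unfolding R_def by blast
    then show "(\<lambda>x. f x + h x) \<in> R"
      unfolding R_def using AP_polynomials.add[OF q(1) r(1)]
      by (auto intro!: continuous_on_add bexI[of _ "\<lambda>z. q z + r z"])
    show "(\<lambda>x. f x * h x) \<in> R"
      unfolding R_def using AP_polynomials.mult[OF q(1) r(1)] \<open>continuous_on _ f\<close> \<open>continuous_on _ h\<close> q(2) r(2)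
      by (auto intro!: continuous_on_mult bexI[of _ "\<lambda>z. q z * r z"])
  next
    fix c show "(\<lambda>_. c) \<in> R"
      unfolding R_def using AP_polynomials.const[of "of_real c" g S] by (auto intro!: bexI[of _ "\<lambda>_. of_real c"])
  next
    fix u v :: real assume uv: "u \<in> {0..2*pi}" "v \<in> {0..2*pi}" "u \<noteq> v"
    have "G \<in> R"
      unfolding R_def using G_cont AP_polynomials.g_var[OF assms(1), of g]
      by (auto intro!: bexI[of _ "\<lambda>z. of_real (g_at g t0 z)"] simp: g_at_cis G_def)
    moreover have "G u \<noteq> G v"
      using G_inj[of u v] G_inj[of v u] uv by (cases "u < v") auto
    ultimately show "\<exists>f\<in>R. f u \<noteq> f v" by blast
  qed
  obtain \<phi> where \<phi>: "\<phi> \<in> R" "\<And>t. t \<in> {0..2*pi} \<Longrightarrow> \<bar>\<psi> t - \<phi> t\<bar> < \<epsilon>"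
    using Stone_Weierstrass_basic[OF assms(2,3)] by blast
  then obtain q where q: "q \<in> AP_polynomials g S" "\<forall>t. 0 < t \<and> t < 2*pi \<longrightarrow> q (cis (t0 + t)) = complex_of_real (\<phi> t)"
    unfolding R_def by blast
  have "cmod (of_real (\<psi> t) - q (cis (t0 + t))) < \<epsilon>" if "0 < t" "t < 2*pi" for t
    using q(2) \<phi>(2)[of t] that by (simp flip: of_real_diff)
  then show ?thesis using q(1) by blast
qed

text \<open>The values of \<open>\<psi>\<close> at 0 and \<open>2*pi\<close> may differ, so
  \<open>p\<close> may jump at \<open>cis t0\<close>; this supplies one-sided cut-offs.\<close>

lemma poly_limit_interval:
  fixes \<psi> :: "real \<Rightarrow> real"
  assumes "cis t0 \<in> S" "continuous_on {0..2*pi} \<psi>"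
    and p: "\<And>t. 0 < t \<Longrightarrow> t < 2*pi \<Longrightarrow> p (cis (t0 + t)) = of_real (\<psi> t)"
  shows "poly_limit S p"
  unfolding poly_limit_def
proof (intro allI impI)
  fix \<epsilon> :: real assume "\<epsilon> > 0"
  then obtain q where q: "q \<in> AP_polynomials g S"
    "\<forall>t. 0 < t \<and> t < 2*pi \<longrightarrow> cmod (of_real (\<psi> t) - q (cis (t0 + t))) < \<epsilon>"
    using poly_limit_real_interval[OF assms(1,2)] by blast
  have "cmod (p z - q z) < \<epsilon>" if z: "z \<in> sphere 0 1 - {cis t0}" for z
  proof -
    define t where "t = arc_param t0 1 z"
    have t: "0 < t" "t < 2*pi" "cis (t0 + t) = z"
      using z arc_param_pos[of 1 z t0] arc_param_bounds(2)[of t0 1 z] cis_arc_param[of 1 z t0] by (auto simp: t_def)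
    then show ?thesis
      using p[of t] q(2)[rule_format, of t] by simp
  qed
  then show "\<exists>q\<in>AP_polynomials g S. \<exists>X. finite X \<and> (\<forall>z\<in>sphere 0 1 - X. cmod (p z - q z) < \<epsilon>)"
    using q(1) by (intro bexI[of _ q] exI[of _ "{cis t0}"]) auto
qed

lemma trig_poly_log_AP_polynomial:
  assumes "P \<in> trig_polys" "cis t0 \<in> S" "k \<in> {-1, 1}"
  shows "(\<lambda>z. P (log_at t0 k z)) \<in> AP_polynomials g S"
  using assms(1)
proof induction
  case (monomial c l)
  have "(\<lambda>z. c * exp (\<i> * of_real (l * log_at t0 k z))) \<in> AP_polynomials g S"
    by (intro AP_polynomials.mult AP_polynomials.const AP_polynomials.exp_var assms)
  then show ?case by (simp only: cis_conv_exp)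
qed (rule AP_polynomials.add)

text \<open>The circle may be cut open at any point of \<open>S\<close>; a continuous function then
  becomes one on the closed interval.\<close>

lemma poly_limit_continuous:
  fixes \<rho> :: "complex \<Rightarrow> real"
  assumes "S \<noteq> {}" "S \<subseteq> sphere 0 1" "continuous_on (sphere 0 1) \<rho>"
  shows "poly_limit S (\<lambda>z. of_real (\<rho> z))"
proof -
  obtain z where z: "z \<in> S" using assms(1) by blast
  then have "cmod z = 1" using assms(2) by auto
  then have S: "cis (Arg z) \<in> S" using z by (simp add: cis_Arg_unit)
  have "continuous_on {0..2*pi} (\<lambda>t. \<rho> (cis (Arg z + t)))"
    by (rule continuous_on_compose2[OF assms(3)]) (auto intro!: continuous_intros continuous_on_cis)
  then show ?thesis
    by (rule poly_limit_interval[OF S]) simp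
qed

text \<open>Since \<open>\<rho>\<close> vanishes at the antipode, its restrictions to the two half
  circles, extended by zero, jump at most at \<open>cis t0\<close>. Each is thus a limit of
  polynomials and may be multiplied by the trigonometric polynomial of its side.\<close>

lemma poly_limit_two_sided:
  fixes \<rho> :: "complex \<Rightarrow> real"
  assumes S: "cis t0 \<in> S" and \<rho>: "continuous_on (sphere 0 1) \<rho>" "\<rho> (cis (t0 + pi)) = 0"
    and P: "P \<in> trig_polys" and Q: "Q \<in> trig_polys"
  shows "poly_limit S (\<lambda>z. of_real (\<rho> z) *
    (if arc_param t0 1 z \<le> pi then P (log_at t0 1 z) else Q (log_at t0 (-1) z)))"
proof -
  have c: "continuous_on X (\<lambda>t. \<rho> (cis (t0 + t)))" for X
    by (rule continuous_on_compose2[OF \<rho>(1)]) (auto intro!: continuous_intros continuous_on_cis)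
  have split: "{0..2*pi} = {0..pi} \<union> {pi..2*pi}" by auto
  have param: "arc_param t0 1 (cis (t0 + t)) = t" if "0 < t" "t < 2*pi" for t
    using arc_param_cis[of 1 t t0] that by simp
  have "continuous_on {0..2*pi} (\<lambda>t. if t \<le> pi then \<rho> (cis (t0 + t)) else 0)"
    unfolding split using \<rho>(2) by (intro continuous_on_cases c continuous_on_const) auto
  then have 1: "poly_limit S (\<lambda>z. of_real (if arc_param t0 1 z \<le> pi then \<rho> z else 0))"
    by (rule poly_limit_interval[OF S]) (simp add: param)
  have "continuous_on {0..2*pi} (\<lambda>t. if t \<le> pi then 0 else \<rho> (cis (t0 + t)))"
    unfolding split using \<rho>(2) by (intro continuous_on_cases c continuous_on_const) auto
  then have 2: "poly_limit S (\<lambda>z. of_real (if arc_param t0 1 z \<le> pi then 0 else \<rho> z))"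
    by (rule poly_limit_interval[OF S]) (simp add: param)
  obtain B where B: "\<And>t. cmod (P t) \<le> B" using trig_poly_bounded[OF P] by metis
  obtain C where C: "\<And>t. cmod (Q t) \<le> C" using trig_poly_bounded[OF Q] by metis
  have "poly_limit S (\<lambda>z. of_real (if arc_param t0 1 z \<le> pi then \<rho> z else 0) * P (log_at t0 1 z) +
      of_real (if arc_param t0 1 z \<le> pi then 0 else \<rho> z) * Q (log_at t0 (-1) z))"
    by (intro poly_limit_add poly_limit_mult_polynomial[OF 1 _ B] poly_limit_mult_polynomial[OF 2 _ C]
        trig_poly_log_AP_polynomial P Q S) auto
  moreover have "(\<lambda>z. of_real (if arc_param t0 1 z \<le> pi then \<rho> z else 0) * P (log_at t0 1 z) +
      of_real (if arc_param t0 1 z \<le> pi then 0 else \<rho> z) * Q (log_at t0 (-1) z)) =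
    (\<lambda>z. of_real (\<rho> z) * (if arc_param t0 1 z \<le> pi then P (log_at t0 1 z) else Q (log_at t0 (-1) z)))"
    by (simp add: fun_eq_iff)
  ultimately show ?thesis by (simp only:)
qed

end

section \<open>Local models and gluing\<close>

text \<open>Bohr's theorem is applied to the extension \<open>F\<close>; the normalisation of the
  arc by \<open>s\<close> is undone by the translation by \<open>- ln s\<close>.\<close>

lemma almost_periodic_on_arc_approximation:
  assumes "almost_periodic_on_arc t0 k s f" "0 < s" "\<epsilon> > 0"
  shows "\<exists>Q\<in>trig_polys. \<forall>u. 0 < u \<and> u < s \<longrightarrow> cmod (f (cis (t0 + of_int k * u)) - Q (ln u)) < \<epsilon>"
proof -
  obtain F where F: "almost_periodic F" "\<forall>t<0. f (cis (t0 + of_int k * s * exp t)) = F t"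
    using assms(1) unfolding almost_periodic_on_arc_def by blast
  obtain P where P: "P \<in> trig_polys" "\<forall>t. cmod (F t - P t) < \<epsilon>"
    using almost_periodic_trig_limit[OF F(1)] assms(3) unfolding trig_limit_def by blast
  have "cmod (f (cis (t0 + of_int k * u)) - P (1 * ln u + - ln s)) < \<epsilon>" if u: "0 < u" "u < s" for u
  proof -
    define t where "t = ln u - ln s"
    have "t < 0" "s * exp t = u"
      using u assms(2) by (simp_all add: t_def exp_diff)
    then have "f (cis (t0 + of_int k * u)) = F t"
      using F(2) by (metis mult.assoc)
    then show ?thesis
      using P(2) by (simp add: t_def)
  qed
  then show ?thesis
    using trig_polys_affine[OF P(1), of 1 "- ln s"] by (intro bexI[of _ "\<lambda>t. P (1 * t + - ln s)"]) auto
qed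

text \<open>The complementary closed arc \<open>K\<close> is compact and misses
  \<open>cis t0\<close>, so a small ball avoids it. As \<open>s < pi\<close>, the antipode belongs
  to \<open>K\<close>.\<close>

lemma ball_inter_circle_subset_arcs:
  assumes "0 < s" "s < pi"
  obtains r where "r > 0" "cis (t0 + pi) \<notin> ball (cis t0) r"
    "\<And>w. cmod w = 1 \<Longrightarrow> w \<in> ball (cis t0) r \<Longrightarrow> arc_param t0 1 w < s \<or> 2*pi - s < arc_param t0 1 w"
proof -
  define K where "K = (\<lambda>t. cis (t0 + t)) ` {s..2*pi - s}"
  have "compact K"
    unfolding K_def by (intro compact_continuous_image continuous_on_cis continuous_intros) auto
  then have "open (- K)"
    by (simp add: compact_imp_closed open_Compl)
  moreover have "cis t0 \<in> - K"
  proof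
    assume "cis t0 \<in> K"
    then obtain t where t: "t \<in> {s..2*pi - s}" "cis (t0 + 0) = cis (t0 + t)"
      by (auto simp: K_def)
    then show False
      using arc_param_cis[of 1 t t0] arc_param_cis[of 1 0 t0] assms by simp
  qed
  ultimately obtain r where r: "r > 0" "ball (cis t0) r \<subseteq> - K"
    using open_contains_ball by blast
  show ?thesis
  proof (rule that[OF r(1)])
    have "cis (t0 + pi) \<in> K"
      unfolding K_def using assms by (intro imageI) auto
    then show "cis (t0 + pi) \<notin> ball (cis t0) r"
      using r(2) by blast
  next
    fix w :: complex assume w: "cmod w = 1" "w \<in> ball (cis t0) r"
    show "arc_param t0 1 w < s \<or> 2*pi - s < arc_param t0 1 w"
    proof (rule ccontr)
      assume "\<not> ?thesis"
      then have "cis (t0 + arc_param t0 1 w) \<in> K"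
        unfolding K_def by (intro imageI) auto
      then show False
        using cis_arc_param[of 1 w t0] w r(2) by auto
    qed
  qed
qed

context arc_generator
begin

text \<open>Off \<open>S\<close> the model is the constant value \<open>h z0\<close> of the
  continuous representative. The conclusion has the same form as at singular points, so that both
  can be glued together.\<close>

lemma local_model_regular:
  assumes S: "closed S" "S \<subseteq> sphere 0 1" "S \<noteq> {}" and f: "f \<in> AP S" and "\<epsilon> > 0"
    and z0: "z0 \<in> sphere 0 1" "z0 \<notin> S"
  shows "\<exists>r>0. \<exists>M. (AE w in circle_measure. w \<in> ball z0 r \<longrightarrow> cmod (f w - M w) \<le> \<epsilon>) \<and>
    (\<forall>\<rho>::complex \<Rightarrow> real. continuous_on (sphere 0 1) \<rho> \<longrightarrow> (\<forall>w\<in>sphere 0 1 - ball z0 r. \<rho> w = 0) \<longrightarrow>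
       poly_limit S (\<lambda>w. of_real (\<rho> w) * M w))"
proof -
  obtain h where h: "continuous_on (sphere 0 1 - S) h" "AE z in circle_measure. z \<notin> S \<longrightarrow> f z = h z"
    using f unfolding AP_def by blast
  obtain d where d: "d > 0" "\<And>w. w \<in> sphere 0 1 - S \<Longrightarrow> dist w z0 < d \<Longrightarrow> dist (h w) (h z0) < \<epsilon>"
    using h(1) z0 \<open>\<epsilon> > 0\<close> unfolding continuous_on_iff by (metis DiffI)
  obtain e where e: "e > 0" "ball z0 e \<subseteq> - S"
    using S(1) z0(2) open_contains_ball[of "- S"] by auto
  show ?thesis
  proof (intro exI[of _ "min d e"] exI[of _ "\<lambda>_. h z0"] conjI allI impI)
    show "0 < min d e" using d(1) e(1) by simp
    show "AE w in circle_measure. w \<in> ball z0 (min d e) \<longrightarrow> cmod (f w - h z0) \<le> \<epsilon>"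
      using h(2) AE_circle_in_sphere
    proof eventually_elim
      case (elim w)
      show ?case
      proof
        assume w: "w \<in> ball z0 (min d e)"
        then have "w \<notin> S" using e(2) by auto
        then show "cmod (f w - h z0) \<le> \<epsilon>"
          using elim d(2)[of w] w by (simp add: dist_norm norm_minus_commute)
      qed
    qed
    fix \<rho> :: "complex \<Rightarrow> real" assume "continuous_on (sphere 0 1) \<rho>"
    then show "poly_limit S (\<lambda>w. of_real (\<rho> w) * h z0)"
      by (intro poly_limit_mult_polynomial[of _ _ _ "cmod (h z0)"] poly_limit_continuous S AP_polynomials.const) auto
  qed
qed

text \<open>Each side of \<open>cis t0\<close> has its own trigonometric polynomial in the
  logarithm. The model switches between them at the antipode, which the ball avoids, so every
  admissible cut-off vanishes there.\<close>

lemma local_model_singular: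
  assumes f: "f \<in> AP S" and "\<epsilon> > 0" and z0: "cis t0 \<in> S"
  shows "\<exists>r>0. \<exists>M. (AE w in circle_measure. w \<in> ball (cis t0) r \<longrightarrow> cmod (f w - M w) \<le> \<epsilon>) \<and>
    (\<forall>\<rho>::complex \<Rightarrow> real. continuous_on (sphere 0 1) \<rho> \<longrightarrow> (\<forall>w\<in>sphere 0 1 - ball (cis t0) r. \<rho> w = 0) \<longrightarrow>
       poly_limit S (\<lambda>w. of_real (\<rho> w) * M w))"
proof -
  have e: "\<epsilon>/2 > 0" using \<open>\<epsilon> > 0\<close> by simp
  obtain s fk where s: "0 < s" "s < pi"
    and fk: "\<And>k. k \<in> {-1, 1} \<Longrightarrow> almost_periodic_on_arc t0 k s (fk k)"
      "\<And>k. k \<in> {-1, 1} \<Longrightarrow> esssup (restrict_space circle_measure (side_arc t0 k s)) (\<lambda>z. ereal (cmod (f z - fk k z))) < ereal (\<epsilon>/2)"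
    using f e unfolding AP_def AP_circle_def by blast
  have s2: "s \<le> 2*pi" using s pi_gt_zero by linarith
  obtain P where P: "P \<in> trig_polys" "\<forall>u. 0 < u \<and> u < s \<longrightarrow> cmod (fk 1 (cis (t0 + of_int 1 * u)) - P (ln u)) < \<epsilon>/2"
    using almost_periodic_on_arc_approximation[OF fk(1) s(1) e, of 1] by auto
  obtain Q where Q: "Q \<in> trig_polys" "\<forall>u. 0 < u \<and> u < s \<longrightarrow> cmod (fk (-1) (cis (t0 + of_int (-1) * u)) - Q (ln u)) < \<epsilon>/2"
    using almost_periodic_on_arc_approximation[OF fk(1) s(1) e, of "-1"] by auto
  have ae: "AE w in circle_measure. w \<in> side_arc t0 k s \<longrightarrow> cmod (f w - fk k w) < \<epsilon>/2" if k: "k \<in> {-1, 1}" for k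
  proof -
    have "AE w in restrict_space circle_measure (side_arc t0 k s). ereal (cmod (f w - fk k w)) < ereal (\<epsilon>/2)"
      using esssup_AE by (rule eventually_mono) (rule le_less_trans[OF _ fk(2)[OF k]])
    then show ?thesis
      using side_arc_measurable[OF k s2] by (subst (asm) AE_restrict_space_iff) auto
  qed
  obtain r where r: "r > 0" "cis (t0 + pi) \<notin> ball (cis t0) r"
    "\<And>w. cmod w = 1 \<Longrightarrow> w \<in> ball (cis t0) r \<Longrightarrow> arc_param t0 1 w < s \<or> 2*pi - s < arc_param t0 1 w"
    using ball_inter_circle_subset_arcs[OF s, of t0] by metis
  let ?M = "\<lambda>z. if arc_param t0 1 z \<le> pi then P (log_at t0 1 z) else Q (log_at t0 (-1) z)"
  show ?thesis
  proof (intro exI[of _ r] exI[of _ ?M] conjI allI impI r(1))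
    have ae1: "AE w in circle_measure. w \<in> side_arc t0 1 s \<longrightarrow> cmod (f w - fk 1 w) < \<epsilon>/2"
      and ae2: "AE w in circle_measure. w \<in> side_arc t0 (-1) s \<longrightarrow> cmod (f w - fk (-1) w) < \<epsilon>/2"
      by (rule ae, simp)+
    show "AE w in circle_measure. w \<in> ball (cis t0) r \<longrightarrow> cmod (f w - ?M w) \<le> \<epsilon>"
      using ae1 ae2 AE_circle_in_sphere AE_circle_neq[of "cis t0"]
    proof eventually_elim
      case (elim w)
      show ?case
      proof
        assume wr: "w \<in> ball (cis t0) r"
        define t where "t = arc_param t0 1 w"
        have t: "0 < t" "t < 2*pi" "cis (t0 + t) = w"
          using elim(3,4) arc_param_pos[of 1 w t0] arc_param_bounds(2)[of t0 1 w] cis_arc_param[of 1 w t0]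
          by (auto simp: t_def)
        have "t < s \<or> 2*pi - s < t"
          unfolding t_def using elim(3) wr by (intro r(3)) auto
        then show "cmod (f w - ?M w) \<le> \<epsilon>"
        proof
          assume ts: "t < s"
          then have M: "?M w = P (ln t)"
            using s by (simp add: log_at_eq flip: t_def)
          have "w \<in> side_arc t0 1 s"
            unfolding side_arc_def using t ts by auto
          then have "cmod (f w - fk 1 w) < \<epsilon>/2"
            using elim(1) by simp
          moreover have "cmod (fk 1 w - P (ln t)) < \<epsilon>/2"
            using P(2)[rule_format, of t] t ts by simp
          ultimately show ?thesis
            unfolding M using norm_triangle_ineq[of "f w - fk 1 w" "fk 1 w - P (ln t)"] by simp
        next
          assume ts: "2*pi - s < t"
          \<comment> \<open>Seen from the negative side, the point is at distance
            \<open>2*pi - t\<close> from \<open>cis t0\<close>.\<close>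
          define u where "u = 2*pi - t"
          have u: "0 < u" "u < s" using t ts by (auto simp: u_def)
          have "2*pi - u = t" by (simp add: u_def)
          then have wu: "w = cis (t0 + of_int (-1) * u)"
            using cis_two_pi_minus[of t0 u] t(3) by simp
          have "log_at t0 (-1) w = ln u"
            unfolding wu using u s2 by (intro log_at_cis) auto
          then have M: "?M w = Q (ln u)"
            using ts s by (simp flip: t_def)
          have "w \<in> side_arc t0 (-1) s"
            unfolding side_arc_def using wu u by blast
          then have "cmod (f w - fk (-1) w) < \<epsilon>/2"
            using elim(2) by simp
          moreover have "cmod (fk (-1) w - Q (ln u)) < \<epsilon>/2"
            using Q(2)[rule_format, of u] u wu by simp
          ultimately show ?thesis
            unfolding M using norm_triangle_ineq[of "f w - fk (-1) w" "fk (-1) w - Q (ln u)"] by simp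
        qed
      qed
    qed
    fix \<rho> :: "complex \<Rightarrow> real"
    assume \<rho>: "continuous_on (sphere 0 1) \<rho>" "\<forall>w\<in>sphere 0 1 - ball (cis t0) r. \<rho> w = 0"
    have "\<rho> (cis (t0 + pi)) = 0"
      using \<rho>(2) r(2) by simp
    then show "poly_limit S (\<lambda>w. of_real (\<rho> w) * ?M w)"
      by (intro poly_limit_two_sided z0 \<rho> P Q)
  qed
qed

text \<open>A finite subcover leaves finitely many models, hence finitely many exceptional null
  sets. Gluing by nonnegative weights with sum one does not enlarge the local error.\<close>

lemma AP_subset_Linf_closure:
  assumes S: "closed S" "S \<subseteq> sphere 0 1" "S \<noteq> {}"
  shows "AP S \<subseteq> Linf_closure (AP_polynomials g S)"
proof
  fix f assume f: "f \<in> AP S"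
  then have fL: "f \<in> Linf" by (simp add: AP_def AP_circle_def)
  have "\<exists>q\<in>AP_polynomials g S. Linf_norm (\<lambda>z. f z - q z) < ereal \<epsilon>" if "\<epsilon> > 0" for \<epsilon>
  proof -
    have e: "\<epsilon>/4 > 0" using that by simp
    define model where "model z r M \<longleftrightarrow> r > 0 \<and> (AE w in circle_measure. w \<in> ball z r \<longrightarrow> cmod (f w - M w) \<le> \<epsilon>/4) \<and>
      (\<forall>\<rho>::complex \<Rightarrow> real. continuous_on (sphere 0 1) \<rho> \<longrightarrow> (\<forall>w\<in>sphere 0 1 - ball z r. \<rho> w = 0) \<longrightarrow>
       poly_limit S (\<lambda>w. of_real (\<rho> w) * M w))" for z r M
    have "\<exists>r M. model z r M" if z: "z \<in> sphere 0 1" for z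
    proof (cases "z \<in> S")
      case True
      have "cis (Arg z) = z" using z by (simp add: cis_Arg_unit)
      then show ?thesis
        using local_model_singular[OF f e, of "Arg z"] True unfolding model_def by auto
    next
      case False
      then show ?thesis
        using local_model_regular[OF S f e z] unfolding model_def by blast
    qed
    then obtain r M where model: "\<And>z. z \<in> sphere 0 1 \<Longrightarrow> model z (r z) (M z)"
      by metis
    have rpos: "r z > 0" if "z \<in> sphere 0 1" for z
      using model[OF that] by (simp add: model_def)
    have "sphere 0 1 \<subseteq> (\<Union>z\<in>sphere 0 1. ball z (r z))"
      using rpos by force
    then obtain D where D: "D \<subseteq> sphere 0 1" "finite D" "sphere 0 1 \<subseteq> (\<Union>z\<in>D. ball z (r z))"
      by (rule compactE_image[OF compact_sphere open_ball])
    \<comment> \<open>Tent functions, positive exactly on the chosen balls. As these cover the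
      circle, the sum has no zero there and can be normalised.\<close>
    define b where "b z w = max 0 (r z - dist z w)" for z w :: complex
    have b_pos: "0 < (\<Sum>z\<in>D. b z w)" if w: "w \<in> sphere 0 1" for w
    proof -
      obtain z where "z \<in> D" "w \<in> ball z (r z)" using D(3) w by blast
      then show ?thesis
        using D(2) by (intro sum_pos2[of D z]) (auto simp: b_def)
    qed
    define \<rho> where "\<rho> z w = b z w / (\<Sum>z\<in>D. b z w)" for z w
    have \<rho>_cont: "continuous_on (sphere 0 1) (\<rho> z)" for z
      unfolding \<rho>_def b_def
      by (intro continuous_intros) (use b_pos in \<open>force simp: b_def\<close>)
    have \<rho>_nonneg: "0 \<le> \<rho> z w" if "w \<in> sphere 0 1" for z w
      using b_pos[OF that] by (simp add: \<rho>_def b_def)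
    have \<rho>_sum: "(\<Sum>z\<in>D. \<rho> z w) = 1" if "w \<in> sphere 0 1" for w
      using b_pos[OF that] by (simp add: \<rho>_def flip: sum_divide_distrib)
    have \<rho>_supp: "\<rho> z w = 0" if "w \<notin> ball z (r z)" for z w
      using that by (simp add: \<rho>_def b_def)
    define p where "p w = (\<Sum>z\<in>D. of_real (\<rho> z w) * M z w)" for w
    have "poly_limit S (\<lambda>w. of_real (\<rho> z w) * M z w)" if "z \<in> D" for z
      using model[of z] that D(1) \<rho>_cont[of z] \<rho>_supp[of _ z] unfolding model_def by blast
    then have "poly_limit S p"
      unfolding p_def[abs_def] using D(2) by (intro poly_limit_sum)
    then obtain q X where q: "q \<in> AP_polynomials g S" "finite X" "\<And>z. z \<in> sphere 0 1 - X \<Longrightarrow> cmod (p z - q z) < \<epsilon>/4"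
      using e by (rule poly_limitD) (rule that)
    have "AE w in circle_measure. \<forall>z\<in>D. w \<in> ball z (r z) \<longrightarrow> cmod (f w - M z w) \<le> \<epsilon>/4"
      using D(1,2) model unfolding model_def by (intro eventually_ball_finite) auto
    then have "AE w in circle_measure. cmod (f w - q w) \<le> \<epsilon>/2"
      using AE_circle_in_sphere AE_circle_not_in_finite[OF q(2)]
    proof eventually_elim
      case (elim w)
      \<comment> \<open>The weights sum to one, so \<open>f w\<close> can be distributed over the
        models. Terms whose ball misses \<open>w\<close> have weight zero and need no estimate of
        \<open>M z w\<close>.\<close>
      have "f w - p w = (\<Sum>z\<in>D. of_real (\<rho> z w) * (f w - M z w))"
        using \<rho>_sum[OF elim(2)]
        by (simp add: p_def right_diff_distrib sum_subtractf flip: sum_distrib_right of_real_sum)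
      also have "cmod \<dots> \<le> (\<Sum>z\<in>D. \<rho> z w * (\<epsilon>/4))"
      proof (rule sum_norm_le)
        fix z assume z: "z \<in> D"
        show "cmod (of_real (\<rho> z w) * (f w - M z w)) \<le> \<rho> z w * (\<epsilon>/4)"
        proof (cases "w \<in> ball z (r z)")
          case True
          then have "cmod (f w - M z w) \<le> \<epsilon>/4"
            using elim(1) z by blast
          then have "\<rho> z w * cmod (f w - M z w) \<le> \<rho> z w * (\<epsilon>/4)"
            by (rule mult_left_mono[OF _ \<rho>_nonneg[OF elim(2)]])
          then show ?thesis
            using \<rho>_nonneg[OF elim(2), of z] by (simp add: norm_mult)
        qed (simp add: \<rho>_supp)
      qed
      also have "\<dots> = \<epsilon>/4"
        unfolding sum_distrib_right[symmetric] \<rho>_sum[OF elim(2)] by simp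
      finally have "cmod (f w - p w) \<le> \<epsilon>/4" .
      moreover have "cmod (p w - q w) < \<epsilon>/4"
        using elim(2,3) by (intro q(3)) auto
      ultimately show ?case
        using norm_triangle_ineq[of "f w - p w" "p w - q w"] by simp
    qed
    moreover have "(\<lambda>w. f w - q w) \<in> borel_measurable circle_measure"
      using fL measurable_AP_polynomial[OF q(1)] by (auto simp: Linf_def)
    ultimately have "Linf_norm (\<lambda>w. f w - q w) \<le> ereal (\<epsilon>/2)"
      by (intro AE_imp_Linf_norm_le)
    also have "\<dots> < ereal \<epsilon>" using that by simp
    finally show ?thesis using q(1) by blast
  qed
  then show "f \<in> Linf_closure (AP_polynomials g S)"
    using fL by (simp add: Linf_closure_def)
qed

end

theorem theorem1p4:
  fixes S :: "complex set" and g :: "complex \<Rightarrow> real"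
  assumes "S \<subseteq> sphere 0 1" and "closed S" and "S \<noteq> {}"
    and "continuous_on (sphere 0 1 - {1}) g"
    and "((\<lambda>t. g (cis t)) \<longlongrightarrow> 1) (at_right 0)"
    and "((\<lambda>t. g (cis t)) \<longlongrightarrow> 0) (at_left (2*pi))"
    and "strict_antimono_on {0<..<2*pi} (\<lambda>t. g (cis t))"
  shows "AP S = Linf_closure (AP_polynomials g S)"
proof -
  interpret arc_generator g
    using assms by unfold_locales
  show ?thesis
    using AP_subset_Linf_closure Linf_closure_subset_AP assms(1-3) by blast
qed

end
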